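(* Assume that $$\sup_n\left|w_{n+1}\frac{a_{n+1}}{a_n}\right|<\infty,\qquad \limsup_n\left|\frac{b_n}{a_{n+1}}\right|<1,\qquad \lim_n\left|w_{n+1}\frac{b_n}{a_n}-w_n\frac{b_{n-1}}{a_{n-1}}\right|=0.$$ Then the following hold. (i) The operator $B_w$ on $\ell^p_{a,b}$, $1\le p<\infty$ (respectively on $c_{0,a,b}$) is similar to $B_\alpha+K$ for some compact operator $K$ on the sequence space $\ell^p$ (respectively $c_0$), where $B_\alpha$ is the weighted backward shift on $\ell^p$ (respectively $c_0$) with weight sequence $\alpha_n=w_n\frac{a_n}{a_{n-1}}$, $n\ge1$. (ii) On $\ell^p_{a,b}$, $1<p<\infty$, the essential spectrum $\sigma_e(B_w)$ is the annulus of all $z\in\mathbb{C}$ with $$\sup_{n\ge1}\left(\inf_{k\ge1}\left|(w_{k+1}w_{k+2}\cdots w_{k+n})\frac{a_{k+n}}{a_k}\right|\right)^{1/n}\le|z|\le\inf_{n\ge1}\left(\sup_{k\ge1}\left|(w_{k+1}w_{k+2}\cdots w_{k+n})\frac{a_{k+n}}{a_k}\right|\right)^{1/n}.$$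
   Context: $\mathbb{D}$ is the open unit disc in $\mathbb{C}$. $a=(a_n)_{n\ge0}$ and $b=(b_n)_{n\ge0}$ are complex sequences with $a_n\ne0$ for all $n$, and $f_n(z)=(a_n+b_nz)z^n$, $n\ge0$. For $1\le p<\infty$, $\ell^p_{a,b}$ is the Banach space of analytic functions on $\mathbb{D}$ of the form $f=\sum_{n\ge0}\lambda_nf_n$ with $(\lambda_n)\in\ell^p$, normed by $\|f\|=(\sum_n|\lambda_n|^p)^{1/p}$ (so $\{f_n\}$ is a normalized Schauder basis equivalent to the standard basis of $\ell^p$, and an orthonormal basis when $p=2$). $c_{0,a,b}$ is the Banach space of analytic functions $f=\sum_{n\ge0}\lambda_nf_n$ on $\mathbb{D}$ with $\lambda_n\to0$, normed by $\|f\|=\sup_n|\lambda_n|$. Standing assumption: each of the sets $\mathcal D_1=\{z\in\mathbb{C}:\sum_n((|a_n|+|b_n|)|z|^n)^q<\infty\}$ (with $1/p+1/q=1$, relevant for $1<p<\infty$), $\mathcal D_2=\{z\in\mathbb{C}:\sup_n(|a_n|+|b_n|)|z|^n<\infty\}$ (relevant for $p=1$) and $\mathcal D_3=\{z\in\mathbb{C}:\sum_n(|a_n|+|b_n|)|z|^n<\infty\}$ (relevant for $c_{0,a,b}$) equals $\mathbb{D}$. $w=(w_n)_{n\ge0}$ is a sequence of non-zero complex numbers, and the weighted backward shift acts on Taylor series by $B_w(\sum_{n\ge0}\lambda_nz^n)=\sum_{n\ge0}w_{n+1}\lambda_{n+1}z^n$. On the sequence spaces $\ell^p$, $c_0$ with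 standard basis $(e_n)_{n\ge0}$, $B_\alpha$ is given by $B_\alpha e_0=0$, $B_\alpha e_n=\alpha_ne_{n-1}$ for $n\ge1$. Two operators $T$ on $X$ and $R$ on $Y$ are similar if $R=UTU^{-1}$ for some bounded invertible $U:X\to Y$. A bounded operator $T$ on a Banach space $X$ is Fredholm if $\ker T$ and $X/T(X)$ are finite dimensional; $\sigma_e(T)$ is the set of $\lambda\in\mathbb{C}$ such that $T-\lambda I$ is not Fredholm. *)

theory Defs
  imports "HOL-Complex_Analysis.Complex_Analysis" "HOL-Library.Function_Algebras"
begin

section \<open>Normed spaces of complex-valued functions\<close>

text \<open>
  All spaces below are linear subspaces of \<open>'i \<Rightarrow> complex\<close> with pointwise operations
  (\<open>'i = nat\<close> for sequence spaces, \<open>'i = complex\<close> for spaces of functions on the disc),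
  given by a carrier and a norm. The value of the norm off the carrier is irrelevant.
\<close>

record 'i fun_space =
  vecs :: "('i \<Rightarrow> complex) set"
  nrm :: "('i \<Rightarrow> complex) \<Rightarrow> real"

definition fscale :: "complex \<Rightarrow> ('i \<Rightarrow> complex) \<Rightarrow> ('i \<Rightarrow> complex)" where
  "fscale c f = (\<lambda>i. c * f i)"

interpretation fvs: vector_space "fscale :: complex \<Rightarrow> ('i \<Rightarrow> complex) \<Rightarrow> ('i \<Rightarrow> complex)"
  by unfold_locales (auto simp: fscale_def algebra_simps)

definition bounded_op ::
    "'i fun_space \<Rightarrow> 'j fun_space \<Rightarrow> (('i \<Rightarrow> complex) \<Rightarrow> ('j \<Rightarrow> complex)) \<Rightarrow> bool" where
  "bounded_op X Y T \<longleftrightarrow>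
     (\<forall>x\<in>vecs X. T x \<in> vecs Y) \<and>
     (\<forall>x\<in>vecs X. \<forall>y\<in>vecs X. T (x + y) = T x + T y) \<and>
     (\<forall>c. \<forall>x\<in>vecs X. T (fscale c x) = fscale c (T x)) \<and>
     (\<exists>C. \<forall>x\<in>vecs X. nrm Y (T x) \<le> C * nrm X x)"

text \<open>
  The absolute value does nothing on the carrier; it is there because \<open>Metric_space\<close>
  asks for nonnegativity on the whole type.
\<close>
definition norm_topology :: "'i fun_space \<Rightarrow> ('i \<Rightarrow> complex) topology" where
  "norm_topology X = Metric_space.mtopology (vecs X) (\<lambda>x y. \<bar>nrm X (x - y)\<bar>)"

definition compact_op ::
    "'i fun_space \<Rightarrow> 'j fun_space \<Rightarrow> (('i \<Rightarrow> complex) \<Rightarrow> ('j \<Rightarrow> complex)) \<Rightarrow> bool" where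
  "compact_op X Y K \<longleftrightarrow> bounded_op X Y K \<and>
     compactin (norm_topology Y)
       (norm_topology Y closure_of (K ` {x \<in> vecs X. nrm X x \<le> 1}))"

definition similar ::
    "'i fun_space \<Rightarrow> (('i \<Rightarrow> complex) \<Rightarrow> ('i \<Rightarrow> complex)) \<Rightarrow>
     'j fun_space \<Rightarrow> (('j \<Rightarrow> complex) \<Rightarrow> ('j \<Rightarrow> complex)) \<Rightarrow> bool" where
  "similar X T Y R \<longleftrightarrow> bounded_op X X T \<and> bounded_op Y Y R \<and>
     (\<exists>U. bounded_op X Y U \<and> bij_betw U (vecs X) (vecs Y) \<and>
          bounded_op Y X (inv_into (vecs X) U) \<and>
          (\<forall>y\<in>vecs Y. R y = U (T (inv_into (vecs X) U y))))"

definition finite_dim :: "('i \<Rightarrow> complex) set \<Rightarrow> bool" where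
  "finite_dim V \<longleftrightarrow> (\<exists>B. finite B \<and> B \<subseteq> V \<and> V = fvs.span B)"

definition coset :: "('i \<Rightarrow> complex) set \<Rightarrow> ('i \<Rightarrow> complex) \<Rightarrow> ('i \<Rightarrow> complex) set" where
  "coset M x = {x + m | m. m \<in> M}"

text \<open>
  \<open>coset M ` V\<close> is the quotient \<open>V/M\<close>; it is finite dimensional iff it is the image of the
  span of a finite subset of \<open>V\<close>, the quotient map being linear.
\<close>
definition finite_dim_quotient :: "('i \<Rightarrow> complex) set \<Rightarrow> ('i \<Rightarrow> complex) set \<Rightarrow> bool" where
  "finite_dim_quotient V M \<longleftrightarrow>
     (\<exists>B. finite B \<and> B \<subseteq> V \<and> coset M ` V = coset M ` fvs.span B)"

definition fredholm :: "'i fun_space \<Rightarrow> (('i \<Rightarrow> complex) \<Rightarrow> ('i \<Rightarrow> complex)) \<Rightarrow> bool" where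
  "fredholm X T \<longleftrightarrow> bounded_op X X T \<and>
     finite_dim {x \<in> vecs X. T x = 0} \<and> finite_dim_quotient (vecs X) (T ` vecs X)"

definition ess_spectrum ::
    "'i fun_space \<Rightarrow> (('i \<Rightarrow> complex) \<Rightarrow> ('i \<Rightarrow> complex)) \<Rightarrow> complex set" where
  "ess_spectrum X T = {\<mu>. \<not> fredholm X (\<lambda>x. T x - fscale \<mu> x)}"


section \<open>Sequence spaces\<close>

definition lp :: "real \<Rightarrow> nat fun_space" where
  "lp p = \<lparr> vecs = {x. summable (\<lambda>n. norm (x n) powr p)},
            nrm = (\<lambda>x. (\<Sum>n. norm (x n) powr p) powr (1 / p)) \<rparr>"

definition c0 :: "nat fun_space" where
  "c0 = \<lparr> vecs = {x. x \<longlonglongrightarrow> 0}, nrm = (\<lambda>x. SUP n. norm (x n)) \<rparr>"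

definition seq_shift :: "(nat \<Rightarrow> complex) \<Rightarrow> (nat \<Rightarrow> complex) \<Rightarrow> (nat \<Rightarrow> complex)" where
  "seq_shift \<alpha> x = (\<lambda>n. \<alpha> (Suc n) * x (Suc n))"


section \<open>Spaces of analytic functions on the unit disc with a tridiagonal kernel basis\<close>

definition basis_fun :: "(nat \<Rightarrow> complex) \<Rightarrow> (nat \<Rightarrow> complex) \<Rightarrow> nat \<Rightarrow> complex \<Rightarrow> complex" where
  "basis_fun a b n z = (a n + b n * z) * z ^ n"

definition expands ::
    "(nat \<Rightarrow> complex) \<Rightarrow> (nat \<Rightarrow> complex) \<Rightarrow> (nat \<Rightarrow> complex) \<Rightarrow> (complex \<Rightarrow> complex) \<Rightarrow> bool" where
  "expands a b l f \<longleftrightarrow> (\<forall>z\<in>ball 0 1. (\<lambda>n. l n * basis_fun a b n z) sums f z)"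

text \<open>
  A function on the disc is represented by its extension by \<open>0\<close>, so that equality of
  representatives is equality on the disc. With \<open>S = lp p\<close> and \<open>S = c0\<close> this gives the
  spaces \<open>\<ell>\<^sup>p\<^bsub>a,b\<^esub>\<close> and \<open>c\<^bsub>0,a,b\<^esub>\<close>. The coefficient sequence is unique when all \<open>a n \<noteq> 0\<close>
  and the disc is contained in the natural domain of convergence below.
\<close>
definition disc_space ::
    "nat fun_space \<Rightarrow> (nat \<Rightarrow> complex) \<Rightarrow> (nat \<Rightarrow> complex) \<Rightarrow> complex fun_space" where
  "disc_space S a b =
     \<lparr> vecs = {f. f holomorphic_on ball 0 1 \<and> (\<forall>z. z \<notin> ball 0 1 \<longrightarrow> f z = 0) \<and>
                  (\<exists>l\<in>vecs S. expands a b l f)},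
       nrm = (\<lambda>f. nrm S (THE l. l \<in> vecs S \<and> expands a b l f)) \<rparr>"

definition dom1 :: "real \<Rightarrow> (nat \<Rightarrow> complex) \<Rightarrow> (nat \<Rightarrow> complex) \<Rightarrow> complex set" where
  "dom1 q a b = {z. summable (\<lambda>n. ((norm (a n) + norm (b n)) * norm z ^ n) powr q)}"

definition dom2 :: "(nat \<Rightarrow> complex) \<Rightarrow> (nat \<Rightarrow> complex) \<Rightarrow> complex set" where
  "dom2 a b = {z. bdd_above (range (\<lambda>n. (norm (a n) + norm (b n)) * norm z ^ n))}"

definition dom3 :: "(nat \<Rightarrow> complex) \<Rightarrow> (nat \<Rightarrow> complex) \<Rightarrow> complex set" where
  "dom3 a b = {z. summable (\<lambda>n. (norm (a n) + norm (b n)) * norm z ^ n)}"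

definition disc_shift :: "(nat \<Rightarrow> complex) \<Rightarrow> (complex \<Rightarrow> complex) \<Rightarrow> (complex \<Rightarrow> complex)" where
  "disc_shift w f = (\<lambda>z. if z \<in> ball 0 1
     then eval_fps (Abs_fps (\<lambda>n. w (Suc n) * fps_nth (fps_expansion f 0) (Suc n))) z
     else 0)"

text \<open>
  \<open>seq_shift\<close> never uses index \<open>0\<close> of its weight, so \<open>a (n - 1)\<close> matters only for \<open>n \<ge> 1\<close>.
\<close>
definition similar_to_compact_pert ::
    "nat fun_space \<Rightarrow> (nat \<Rightarrow> complex) \<Rightarrow> (nat \<Rightarrow> complex) \<Rightarrow> (nat \<Rightarrow> complex) \<Rightarrow> bool" where
  "similar_to_compact_pert S a b w \<longleftrightarrow>
     (\<exists>K. compact_op S S K \<and>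
        similar (disc_space S a b) (disc_shift w)
          S (\<lambda>x. seq_shift (\<lambda>n. w n * (a n / a (n - 1))) x + K x))"

text \<open>\<open>|w\<^bsub>k+1\<^esub> \<cdots> w\<^bsub>k+n\<^esub> a\<^bsub>k+n\<^esub> / a\<^bsub>k\<^esub>|\<close>\<close>
definition weight_prod :: "(nat \<Rightarrow> complex) \<Rightarrow> (nat \<Rightarrow> complex) \<Rightarrow> nat \<Rightarrow> nat \<Rightarrow> real" where
  "weight_prod a w n k = norm ((\<Prod>i=1..n. w (k + i)) * (a (k + n) / a k))"

end

theory Submission
  imports Defs
begin

text \<open>
  If \<open>t n\<close> are the Taylor coefficients of \<open>f = (\<Sum>n. l n * f\<^sub>n)\<close>, then
  \<open>t n / a n = l n + (b (n - 1) / a n) * l (n - 1)\<close>. Since \<open>limsup |b n / a (n + 1)| < 1\<close>, this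
  bidiagonal transformation is an isomorphism of the sequence space, so
  \<open>f \<mapsto> (t n / a n)\<close> identifies \<open>\<ell>\<^sup>p\<^bsub>a,b\<^esub>\<close> with \<open>\<ell>\<^sup>p\<close> and turns \<open>B\<^sub>w\<close> into \<open>B\<^sub>\<alpha>\<close> exactly:
  the compact perturbation can be taken to be \<open>0\<close>.

  The essential spectrum is therefore that of \<open>B\<^sub>\<alpha>\<close>. The kernel of \<open>B\<^sub>\<alpha> - \<mu>\<close> is at most
  one-dimensional. Put \<open>\<phi> n = \<alpha> 1 \<cdots> \<alpha> n / \<mu> ^ n\<close>. Off the annulus, \<open>|\<phi>|\<close> grows or decays
  uniformly geometrically and the recursion \<open>(B\<^sub>\<alpha> - \<mu>) x = y\<close> can be solved explicitly in \<open>\<ell>\<^sup>p\<close>. In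
  the annulus it does neither, so \<open>|\<phi>| ^ q\<close> has arbitrarily late bumps whose mass dwarfs their two
  end points. Each bump yields a small right-hand side all of whose formal solutions are large, and
  a gliding hump argument shows that the range has infinite codimension.
\<close>


section \<open>The sequence spaces\<close>

text \<open>The limsup condition controls the subdiagonal only from some index on, so inverting the
  bidiagonal map takes a rescaling besides the geometric series. The space enters this inversion
  only through solidity, scaling and convolution with \<open>\<theta> ^ n\<close>;
  \<open>seq_space\<close> axiomatises these, and l^p and c_0 are treated together. In the annulus
  the range of \<open>L\<close> may fail to be closed, so its codimension is not read off from
  annihilating functionals. Instead every finite set offered as spanning a complement is refuted
  directly. A strict violation of one of the two annulus inequalities is witnessed by a single
  window length, with a contraction factor common to all windows; iteration gives the geometric
  rate. Inside the annulus only uniform rates are excluded, and the link from there to bumps is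
  quantitative: if every late block sum were at most \<open>C\<close> times the sum of its two end
  point values, a uniform rate would follow. Comparing a block with its end points is Hoelder's
  inequality with a finite exponent \<open>q\<close>, which is where 1 < p is used.\<close>

locale seq_space =
  fixes S :: "nat fun_space"
  assumes zero_mem: "0 \<in> vecs S"
    and add_mem: "x \<in> vecs S \<Longrightarrow> y \<in> vecs S \<Longrightarrow> x + y \<in> vecs S"
    and triangle: "x \<in> vecs S \<Longrightarrow> y \<in> vecs S \<Longrightarrow> nrm S (x + y) \<le> nrm S x + nrm S y"
    and scale_mem: "x \<in> vecs S \<Longrightarrow> fscale c x \<in> vecs S"
    and nrm_scale: "x \<in> vecs S \<Longrightarrow> nrm S (fscale c x) = norm c * nrm S x"
    and nrm_cong: "(\<And>n. norm (x n) = norm (y n)) \<Longrightarrow> nrm S x = nrm S y"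
    and norm_le_nrm: "x \<in> vecs S \<Longrightarrow> norm (x n) \<le> nrm S x"
    and solid: "x \<in> vecs S \<Longrightarrow> (\<And>n. norm (y n) \<le> norm (x n)) \<Longrightarrow> y \<in> vecs S \<and> nrm S y \<le> nrm S x"
    and left_shift: "x \<in> vecs S \<Longrightarrow> (\<lambda>n. x (Suc n)) \<in> vecs S \<and> nrm S (\<lambda>n. x (Suc n)) \<le> nrm S x"
    and right_shift: "x \<in> vecs S \<Longrightarrow> case_nat 0 x \<in> vecs S \<and> nrm S (case_nat 0 x) \<le> nrm S x"
    and geometric_conv: "y \<in> vecs S \<Longrightarrow> 0 \<le> \<theta> \<Longrightarrow> \<theta> < 1 \<Longrightarrow> norm (z 0) = norm (y 0) \<Longrightarrow>
      (\<And>n. norm (z (Suc n)) = \<theta> * norm (z n) + norm (y (Suc n))) \<Longrightarrow>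
      z \<in> vecs S \<and> nrm S z \<le> nrm S y / (1 - \<theta>)"

section \<open>The spaces \<open>lp p\<close>: Minkowski's inequality, shifts and geometric
  convolutions\<close>

lemma powr_convex_nonneg:
  fixes u v l p :: real
  assumes "0 \<le> u" "0 \<le> v" "0 \<le> l" "l \<le> 1" "1 \<le> p"
  shows "(l * u + (1 - l) * v) powr p \<le> l * u powr p + (1 - l) * v powr p"
proof -
  \<comment> \<open>If \<open>u\<close> or \<open>v\<close> vanishes, convexity on the positive
    half-line does not apply; the claim then reduces to \<open>c powr p \<le> c\<close> on
    [0, 1].\<close>
  have scale: "(c * t) powr p \<le> c * t powr p" if "0 \<le> c" "c \<le> 1" "0 \<le> t" for c t :: real
  proof -
    have "c powr p \<le> c powr 1 \<or> c = 0" using that assms powr_mono'[of 1 p c] by auto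
    then have "c powr p \<le> c" using that assms by (auto simp: powr_one)
    then show ?thesis using that by (simp add: powr_mult mult_right_mono)
  qed
  consider "u = 0" | "v = 0" | "0 < u" "0 < v" using assms by linarith
  then show ?thesis
  proof cases
    case 1 then show ?thesis using scale[of "1 - l" v] assms by simp
  next
    case 2 then show ?thesis using scale[of l u] assms by simp
  next
    case 3
    then show ?thesis
      using convex_onD[OF powr_convex[OF assms(5)], of "1 - l" u v] assms by (simp add: algebra_simps)
  qed
qed

lemma lp_sum_le:
  assumes "1 \<le> p" "x \<in> vecs (lp p)" "finite F"
  shows "(\<Sum>n\<in>F. norm (x n) powr p) \<le> nrm (lp p) x powr p"
proof -
  have s: "summable (\<lambda>n. norm (x n) powr p)" using assms by (simp add: lp_def)
  have "nrm (lp p) x powr p = (\<Sum>n. norm (x n) powr p)"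
    using assms suminf_nonneg[OF s] by (simp add: lp_def powr_powr)
  then show ?thesis using sum_le_suminf[OF s assms(3)] by simp
qed

lemma lpI:
  assumes "1 \<le> p" "0 \<le> C" "\<And>N. (\<Sum>n<N. norm (x n) powr p) \<le> C powr p"
  shows "x \<in> vecs (lp p) \<and> nrm (lp p) x \<le> C"
proof -
  have s: "summable (\<lambda>n. norm (x n) powr p)" by (rule summableI_nonneg_bounded[OF _ assms(3)]) simp
  have "(\<Sum>n. norm (x n) powr p) \<le> C powr p" by (rule suminf_le_const[OF s assms(3)])
  then have "(\<Sum>n. norm (x n) powr p) powr (1/p) \<le> (C powr p) powr (1/p)"
    using assms(1) suminf_nonneg[OF s] by (intro powr_mono2) auto
  then show ?thesis using s assms by (simp add: lp_def powr_powr)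
qed

lemma lp_nrm_nonneg: "0 \<le> nrm (lp p) x"
  by (simp add: lp_def)

lemma lp_norm_le_nrm:
  assumes "1 \<le> p" "x \<in> vecs (lp p)"
  shows "norm (x n) \<le> nrm (lp p) x"
proof -
  have "norm (x n) powr p \<le> nrm (lp p) x powr p" using lp_sum_le[OF assms, of "{n}"] by simp
  then show ?thesis
    using assms(1) lp_nrm_nonneg[of p x] powr_less_mono2[of p "nrm (lp p) x" "norm (x n)"] by linarith
qed

text \<open>Minkowski: \<open>x\<close> and \<open>y\<close> are divided by their norms, and
  convexity of \<open>powr p\<close> with weight \<open>l = ?A / (?A + ?B)\<close> is applied
  entrywise and summed. Admitting any \<open>z\<close> dominated entrywise covers truncations and
  sums of moduli, not only \<open>x + y\<close>.\<close>

lemma lp_triangle: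
  assumes p: "1 \<le> p" and x: "x \<in> vecs (lp p)" and y: "y \<in> vecs (lp p)"
    and z: "\<And>n. norm (z n) \<le> norm (x n) + norm (y n)"
  shows "z \<in> vecs (lp p) \<and> nrm (lp p) z \<le> nrm (lp p) x + nrm (lp p) y"
proof (rule lpI[OF p])
  let ?A = "nrm (lp p) x" and ?B = "nrm (lp p) y"
  show "0 \<le> ?A + ?B" using lp_nrm_nonneg by (simp add: add_nonneg_nonneg)
  fix N
  have le: "(\<Sum>n<N. norm (z n) powr p) \<le> (\<Sum>n<N. (norm (x n) + norm (y n)) powr p)"
    using p z by (intro sum_mono powr_mono2) auto
  consider "?A = 0" | "?B = 0" | "0 < ?A" "0 < ?B"
    using lp_nrm_nonneg[of p x] lp_nrm_nonneg[of p y] by linarith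
  then show "(\<Sum>n<N. norm (z n) powr p) \<le> (?A + ?B) powr p"
  proof cases
    case 1
    then have "x n = 0" for n using lp_norm_le_nrm[OF p x, of n] by simp
    then show ?thesis using le lp_sum_le[OF p y, of "{..<N}"] 1 by simp
  next
    case 2
    then have "y n = 0" for n using lp_norm_le_nrm[OF p y, of n] by simp
    then show ?thesis using le lp_sum_le[OF p x, of "{..<N}"] 2 by simp
  next
    case 3
    define l where "l = ?A / (?A + ?B)"
    have l: "0 \<le> l" "l \<le> 1" "1 - l = ?B / (?A + ?B)" using 3 by (auto simp: l_def field_simps)
    have pt: "(norm (x n) + norm (y n)) powr p \<le> (?A + ?B) powr p *
       (l * (norm (x n) powr p / ?A powr p) + (1 - l) * (norm (y n) powr p / ?B powr p))" for n
    proof -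
      have "l * (norm (x n) / ?A) = norm (x n) / (?A + ?B)"
        "(1 - l) * (norm (y n) / ?B) = norm (y n) / (?A + ?B)"
        unfolding l(3) unfolding l_def using 3 by simp_all
      then have "norm (x n) + norm (y n) =
          (?A + ?B) * (l * (norm (x n) / ?A) + (1 - l) * (norm (y n) / ?B))"
        using 3 by (simp flip: add_divide_distrib)
      then have "(norm (x n) + norm (y n)) powr p =
          (?A + ?B) powr p * (l * (norm (x n) / ?A) + (1 - l) * (norm (y n) / ?B)) powr p"
        using 3 l by (simp add: powr_mult)
      also have "\<dots> \<le> (?A + ?B) powr p *
          (l * (norm (x n) / ?A) powr p + (1 - l) * (norm (y n) / ?B) powr p)"
        using 3 l p by (intro mult_left_mono powr_convex_nonneg) auto
      finally show ?thesis using 3 by (simp add: powr_divide)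
    qed
    have "(\<Sum>n<N. (norm (x n) + norm (y n)) powr p) \<le> (?A + ?B) powr p *
       (l * ((\<Sum>n<N. norm (x n) powr p) / ?A powr p) + (1 - l) * ((\<Sum>n<N. norm (y n) powr p) / ?B powr p))"
      using sum_mono[of "{..<N}", OF pt]
      by (simp add: sum_distrib_left sum.distrib sum_divide_distrib distrib_left)
    also have "\<dots> \<le> (?A + ?B) powr p * (l * 1 + (1 - l) * 1)"
      using 3 l lp_sum_le[OF p x, of "{..<N}"] lp_sum_le[OF p y, of "{..<N}"]
      by (intro mult_left_mono add_mono) (auto simp: divide_le_eq)
    finally show ?thesis using le by simp
  qed
qed

lemma lp_solid:
  assumes "1 \<le> p" "x \<in> vecs (lp p)" "\<And>n. norm (y n) \<le> norm (x n)"
  shows "y \<in> vecs (lp p) \<and> nrm (lp p) y \<le> nrm (lp p) x"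
proof (rule lpI[OF assms(1) lp_nrm_nonneg])
  fix N
  have "(\<Sum>n<N. norm (y n) powr p) \<le> (\<Sum>n<N. norm (x n) powr p)"
    using assms by (intro sum_mono powr_mono2) auto
  then show "(\<Sum>n<N. norm (y n) powr p) \<le> nrm (lp p) x powr p"
    using lp_sum_le[OF assms(1,2), of "{..<N}"] by simp
qed

lemma lp_left_shift:
  assumes "1 \<le> p" "x \<in> vecs (lp p)"
  shows "(\<lambda>n. x (Suc n)) \<in> vecs (lp p) \<and> nrm (lp p) (\<lambda>n. x (Suc n)) \<le> nrm (lp p) x"
proof (rule lpI[OF assms(1) lp_nrm_nonneg])
  fix N
  show "(\<Sum>n<N. norm (x (Suc n)) powr p) \<le> nrm (lp p) x powr p"
    using lp_sum_le[OF assms, of "Suc ` {..<N}"] by (simp add: sum.reindex)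
qed

lemma lp_right_shift:
  assumes "1 \<le> p" "x \<in> vecs (lp p)"
  shows "case_nat 0 x \<in> vecs (lp p) \<and> nrm (lp p) (case_nat 0 x) \<le> nrm (lp p) x"
proof (rule lpI[OF assms(1) lp_nrm_nonneg])
  fix N
  show "(\<Sum>n<N. norm (case n of 0 \<Rightarrow> 0 | Suc m \<Rightarrow> x m) powr p) \<le> nrm (lp p) x powr p"
    using lp_sum_le[OF assms, of "{..<N - 1}"]
    by (cases N) (simp_all add: sum.lessThan_Suc_shift del: sum.lessThan_Suc)
qed

lemma lp_finite_support:
  assumes "1 \<le> p" "\<And>n. N < n \<Longrightarrow> x n = 0"
  shows "x \<in> vecs (lp p)"
proof -
  have "summable (\<lambda>n. norm (x n) powr p)"
    by (rule summable_finite[of "{..N}"]) (use assms in \<open>auto simp: not_le\<close>)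
  then show ?thesis by (simp add: lp_def)
qed

text \<open>Truncations have finite norm whatever \<open>x\<close> is, so an estimate that bounds
  the norm of a truncation by a constant plus \<open>\<theta>\<close> times itself can be solved for
  that norm. The bound, uniform in \<open>N\<close>, then passes to \<open>x\<close>.\<close>

lemma lp_of_truncations:
  assumes p: "1 \<le> p"
    and le: "\<And>N. nrm (lp p) (\<lambda>n. if n \<le> N then x n else 0) \<le> C"
  shows "x \<in> vecs (lp p) \<and> nrm (lp p) x \<le> C"
proof -
  have C: "0 \<le> C" using le[of 0] lp_nrm_nonneg order_trans by blast
  show ?thesis
  proof (rule lpI[OF p C])
    fix N
    let ?t = "\<lambda>n. if n \<le> N then x n else 0"
    have "(\<Sum>n<N. norm (x n) powr p) = (\<Sum>n<N. norm (?t n) powr p)" by (intro sum.cong) auto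
    also have "\<dots> \<le> nrm (lp p) ?t powr p"
      by (rule lp_sum_le[OF p lp_finite_support[OF p, of N]]) auto
    also have "\<dots> \<le> C powr p" using le lp_nrm_nonneg p by (intro powr_mono2) auto
    finally show "(\<Sum>n<N. norm (x n) powr p) \<le> C powr p" .
  qed
qed

lemma lp_scale:
  assumes "1 \<le> p" "x \<in> vecs (lp p)"
  shows "fscale c x \<in> vecs (lp p) \<and> nrm (lp p) (fscale c x) = norm c * nrm (lp p) x"
proof -
  have s: "summable (\<lambda>n. norm (x n) powr p)" using assms by (simp add: lp_def)
  show ?thesis
    using summable_mult[OF s, of "norm c powr p"] suminf_mult[OF s, of "norm c powr p"] assms(1)
      suminf_nonneg[OF s]
    by (simp add: lp_def fscale_def norm_mult powr_mult powr_powr)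
qed

text \<open>Young's inequality for the kernel \<open>\<theta> ^ n\<close>, whose mass is
  \<open>1 / (1 - \<theta>)\<close>. A truncation of \<open>z\<close> is dominated by
  \<open>y\<close> plus \<open>\<theta>\<close> times its own right shift; the shift does not
  increase the norm, so that term is absorbed.\<close>

lemma lp_geometric_conv:
  assumes p: "1 \<le> p" and y: "y \<in> vecs (lp p)" and \<theta>: "0 \<le> \<theta>" "\<theta> < 1"
    and z0: "norm (z 0) = norm (y 0)"
    and zS: "\<And>n. norm (z (Suc n)) = \<theta> * norm (z n) + norm (y (Suc n))"
  shows "z \<in> vecs (lp p) \<and> nrm (lp p) z \<le> nrm (lp p) y / (1 - \<theta>)"
proof (rule lp_of_truncations[OF p])
  fix N
  let ?t = "\<lambda>n. if n \<le> N then z n else 0"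
  have t: "?t \<in> vecs (lp p)" by (rule lp_finite_support[OF p, of N]) auto
  note s = lp_scale[OF p conjunct1[OF lp_right_shift[OF p t]], of "of_real \<theta>"]
  have "nrm (lp p) ?t \<le> nrm (lp p) y + nrm (lp p) (fscale (of_real \<theta>) (case_nat 0 ?t))"
  proof (rule conjunct2[OF lp_triangle[OF p y conjunct1[OF s]]])
    fix n
    show "norm (?t n) \<le> norm (y n) + norm (fscale (of_real \<theta>) (case_nat 0 ?t) n)"
      using z0 zS \<theta> by (cases n) (auto simp: fscale_def norm_mult)
  qed
  also have "nrm (lp p) (fscale (of_real \<theta>) (case_nat 0 ?t)) \<le> \<theta> * nrm (lp p) ?t"
    using conjunct2[OF s] conjunct2[OF lp_right_shift[OF p t]] \<theta> by (simp add: mult_left_mono)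
  finally show "nrm (lp p) ?t \<le> nrm (lp p) y / (1 - \<theta>)" using \<theta> by (simp add: field_simps)
qed

text \<open>The mirror image, absorbing a left shift. The bound \<open>Z\<close> excludes solutions
  that grow like \<open>(1 / \<theta>) ^ n\<close>.\<close>

lemma lp_reverse_geometric_conv:
  assumes p: "1 \<le> p" and y: "y \<in> vecs (lp p)" and \<theta>: "0 \<le> \<theta>" "\<theta> < 1"
    and bdd: "\<And>n. norm (z n) \<le> Z"
    and z: "\<And>n. norm (z n) \<le> \<theta> * norm (z (Suc n)) + norm (y n)"
  shows "z \<in> vecs (lp p)"
proof (rule conjunct1[OF lp_of_truncations[OF p]])
  fix N
  let ?t = "\<lambda>n. if n \<le> N then z n else 0"
  \<comment> \<open>Cutting \<open>z\<close> after \<open>N\<close> removes the entry at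
    \<open>Suc N\<close> on which the estimate at \<open>N\<close> relies; \<open>?e\<close>
    restores it at a cost \<open>\<theta> * Z\<close> independent of \<open>N\<close>.\<close>
  let ?e = "\<lambda>n. if n = N then of_real (\<theta> * Z) else (0 :: complex)"
  have Z: "0 \<le> Z" using bdd[of 0] norm_ge_zero order_trans by blast
  have t: "?t \<in> vecs (lp p)" by (rule lp_finite_support[OF p, of N]) auto
  have e: "?e \<in> vecs (lp p) \<and> nrm (lp p) ?e \<le> \<theta> * Z"
  proof (rule lpI[OF p])
    fix M
    have "(\<Sum>n<M. norm (?e n) powr p) = (\<Sum>n<M. if n = N then (\<theta> * Z) powr p else 0)"
      using \<theta> Z by (intro sum.cong) (auto simp: norm_mult)
    also have "\<dots> \<le> (\<theta> * Z) powr p" by (auto simp: sum.delta)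
    finally show "(\<Sum>n<M. norm (?e n) powr p) \<le> (\<theta> * Z) powr p" .
  qed (use \<theta> Z in simp)
  note s = lp_scale[OF p conjunct1[OF lp_left_shift[OF p t]], of "of_real \<theta>"]
  let ?s = "fscale (of_real \<theta>) (\<lambda>n. ?t (Suc n))"
  have ye: "(\<lambda>n. of_real (norm (y n) + norm (?e n))) \<in> vecs (lp p) \<and>
      nrm (lp p) (\<lambda>n. of_real (norm (y n) + norm (?e n))) \<le> nrm (lp p) y + nrm (lp p) ?e"
    by (rule lp_triangle[OF p y conjunct1[OF e]]) (simp only: norm_of_real; simp)
  have "nrm (lp p) ?t \<le> nrm (lp p) (\<lambda>n. of_real (norm (y n) + norm (?e n))) + nrm (lp p) ?s"
  proof (rule conjunct2[OF lp_triangle[OF p conjunct1[OF ye] conjunct1[OF s]]])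
    fix n
    have "norm (?t n) \<le> norm (y n) + norm (?e n) + norm (?s n)"
      using z[of n] bdd[of "Suc N"] mult_left_mono[OF bdd[of "Suc N"] \<theta>(1)] \<theta> Z
      by (auto simp: fscale_def norm_mult not_le less_Suc_eq_le)
    then show "norm (?t n) \<le> norm (complex_of_real (norm (y n) + norm (?e n))) + norm (?s n)"
      by (simp only: norm_of_real)
  qed
  also have "nrm (lp p) ?s \<le> \<theta> * nrm (lp p) ?t"
    using conjunct2[OF s] conjunct2[OF lp_left_shift[OF p t]] \<theta> by (simp add: mult_left_mono)
  finally show "nrm (lp p) ?t \<le> (nrm (lp p) y + \<theta> * Z) / (1 - \<theta>)"
    using \<theta> ye e by (simp add: field_simps)
qed

lemma seq_space_lp:
  assumes p: "1 \<le> p"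
  shows "seq_space (lp p)"
proof
  show "0 \<in> vecs (lp p)" using p by (simp add: lp_def)
next
  fix x y :: "nat \<Rightarrow> complex" assume "\<And>n. norm (x n) = norm (y n)"
  then show "nrm (lp p) x = nrm (lp p) y" by (simp add: lp_def)
next
  fix x y assume xy: "x \<in> vecs (lp p)" "y \<in> vecs (lp p)"
  have "x + y \<in> vecs (lp p) \<and> nrm (lp p) (x + y) \<le> nrm (lp p) x + nrm (lp p) y"
    by (rule lp_triangle[OF p xy]) (simp add: norm_triangle_ineq)
  then show "x + y \<in> vecs (lp p)" "nrm (lp p) (x + y) \<le> nrm (lp p) x + nrm (lp p) y" by auto
qed (rule conjunct1[OF lp_scale[OF p]] conjunct2[OF lp_scale[OF p]] lp_norm_le_nrm[OF p] lp_solid[OF p]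
      lp_left_shift[OF p] lp_right_shift[OF p] lp_geometric_conv[OF p], assumption+)+

section \<open>The space \<open>c0\<close>\<close>

lemma c0_bdd:
  assumes "x \<in> vecs c0"
  shows "bdd_above (range (\<lambda>n. norm (x n)))"
proof -
  have "Bseq x" using assms by (auto simp: c0_def intro: convergent_imp_Bseq convergentI)
  then obtain K where "\<forall>n. norm (x n) \<le> K" by (auto simp: Bseq_def)
  then show ?thesis by (intro bdd_aboveI2) auto
qed

lemma c0_norm_le_nrm: "x \<in> vecs c0 \<Longrightarrow> norm (x n) \<le> nrm c0 x"
  using cSUP_upper[OF UNIV_I c0_bdd] by (simp add: c0_def)

lemma c0_nrm_le: "(\<And>n. norm (x n) \<le> C) \<Longrightarrow> nrm c0 x \<le> C"
  by (simp add: c0_def cSUP_least)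

text \<open>The recursion is restarted at a late \<open>N\<close>: the influence of
  \<open>z N\<close> dies out like \<open>\<theta> ^ n\<close>, and inputs of size at most
  \<open>C\<close> after \<open>N\<close> contribute at most
  \<open>C / (1 - \<theta>)\<close>.\<close>

lemma c0_geometric_conv:
  assumes y: "y \<in> vecs c0" and \<theta>: "0 \<le> \<theta>" "\<theta> < 1"
    and z0: "norm (z 0) = norm (y 0)"
    and zS: "\<And>n. norm (z (Suc n)) = \<theta> * norm (z n) + norm (y (Suc n))"
  shows "z \<in> vecs c0 \<and> nrm c0 z \<le> nrm c0 y / (1 - \<theta>)"
proof
  let ?Y = "nrm c0 y"
  have geo: "norm (z (N + n)) \<le> \<theta> ^ n * norm (z N) + C / (1 - \<theta>)"
    if C: "\<And>n. N < n \<Longrightarrow> norm (y n) \<le> C" for N n C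
  proof (induction n)
    case 0
    have "0 \<le> C" using C[of "Suc N"] norm_ge_zero order_trans by blast
    then show ?case using \<theta> by simp
  next
    case (Suc n)
    have "norm (z (N + Suc n)) \<le> \<theta> * (\<theta> ^ n * norm (z N) + C / (1 - \<theta>)) + C"
      using zS[of "N + n"] mult_left_mono[OF Suc \<theta>(1)] C[of "Suc (N + n)"] by simp
    also have "\<dots> = \<theta> ^ Suc n * norm (z N) + C / (1 - \<theta>)" using \<theta> by (simp add: field_simps)
    finally show ?case .
  qed
  have zb: "norm (z n) \<le> ?Y / (1 - \<theta>)" for n
  proof (induction n)
    case 0
    have "0 \<le> ?Y" using c0_norm_le_nrm[OF y, of 0] norm_ge_zero order_trans by blast
    then have "?Y * 1 \<le> ?Y / (1 - \<theta>)" using \<theta> by (simp add: field_simps)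
    then show ?case using z0 c0_norm_le_nrm[OF y, of 0] by simp
  next
    case (Suc n)
    have "norm (z (Suc n)) \<le> \<theta> * (?Y / (1 - \<theta>)) + ?Y"
      using zS[of n] mult_left_mono[OF Suc \<theta>(1)] c0_norm_le_nrm[OF y, of "Suc n"] by simp
    also have "\<dots> = ?Y / (1 - \<theta>)" using \<theta> by (simp add: field_simps)
    finally show ?case .
  qed
  then show "nrm c0 z \<le> ?Y / (1 - \<theta>)" by (rule c0_nrm_le)
  have "z \<longlonglongrightarrow> 0"
  proof (rule LIMSEQ_I)
    fix e :: real assume e: "0 < e"
    define C where "C = e * (1 - \<theta>) / 2"
    have "C > 0" using e \<theta> by (simp add: C_def)
    then obtain N where N: "\<And>n. N \<le> n \<Longrightarrow> norm (y n) < C"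
      using y LIMSEQ_D[of y 0 C] by (auto simp: c0_def)
    have Ce: "C / (1 - \<theta>) = e / 2"
      unfolding C_def using nonzero_mult_div_cancel_right[of "1 - \<theta>" "e / 2"] \<theta> by simp
    have "(\<lambda>n. \<theta> ^ n * norm (z N)) \<longlonglongrightarrow> 0"
      using \<theta> by (intro tendsto_mult_left_zero LIMSEQ_power_zero) auto
    then obtain M where M: "\<And>n. M \<le> n \<Longrightarrow> norm (\<theta> ^ n * norm (z N)) < e / 2"
      using e LIMSEQ_D[of "\<lambda>n. \<theta> ^ n * norm (z N)" 0 "e / 2"] by auto
    show "\<exists>no. \<forall>n\<ge>no. norm (z n - 0) < e"
    proof (intro exI allI impI)
      fix n assume n: "N + M \<le> n"
      have "norm (z (N + (n - N))) \<le> \<theta> ^ (n - N) * norm (z N) + C / (1 - \<theta>)"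
        by (rule geo) (use N in \<open>simp add: less_imp_le\<close>)
      moreover have "norm (\<theta> ^ (n - N) * norm (z N)) < e / 2" using M n by simp
      ultimately show "norm (z n - 0) < e" using n Ce by (simp add: abs_if split: if_splits)
    qed
  qed
  then show "z \<in> vecs c0" by (simp add: c0_def)
qed

lemma seq_space_c0: "seq_space c0"
proof
  show "0 \<in> vecs c0" by (simp add: c0_def zero_fun_def)
next
  fix x y :: "nat \<Rightarrow> complex" assume "\<And>n. norm (x n) = norm (y n)"
  then show "nrm c0 x = nrm c0 y" by (simp add: c0_def)
next
  fix x y assume xy: "x \<in> vecs c0" "y \<in> vecs c0"
  then show "x + y \<in> vecs c0" using tendsto_add[of x 0 sequentially y 0] by (simp add: c0_def plus_fun_def)
  show "nrm c0 (x + y) \<le> nrm c0 x + nrm c0 y"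
  proof (rule c0_nrm_le)
    fix n
    show "norm ((x + y) n) \<le> nrm c0 x + nrm c0 y"
      using norm_triangle_ineq[of "x n" "y n"] c0_norm_le_nrm[OF xy(1), of n] c0_norm_le_nrm[OF xy(2), of n]
      by simp
  qed
next
  fix x c assume x: "x \<in> vecs c0"
  show m: "fscale c x \<in> vecs c0"
    using x tendsto_mult_right_zero[of x sequentially c] by (simp add: c0_def fscale_def)
  show "nrm c0 (fscale c x) = norm c * nrm c0 x"
  proof (rule antisym)
    show "nrm c0 (fscale c x) \<le> norm c * nrm c0 x"
      by (rule c0_nrm_le) (simp add: fscale_def norm_mult mult_left_mono c0_norm_le_nrm[OF x])
    show "norm c * nrm c0 x \<le> nrm c0 (fscale c x)"
    proof (cases "c = 0")
      case True
      then show ?thesis using c0_norm_le_nrm[OF m, of 0] by (simp add: fscale_def)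
    next
      case False
      have "nrm c0 x \<le> nrm c0 (fscale c x) / norm c"
      proof (rule c0_nrm_le)
        fix n show "norm (x n) \<le> nrm c0 (fscale c x) / norm c"
          using c0_norm_le_nrm[OF m, of n] False by (simp add: fscale_def norm_mult field_simps)
      qed
      then show ?thesis using False by (simp add: field_simps)
    qed
  qed
next
  fix x y :: "nat \<Rightarrow> complex" assume x: "x \<in> vecs c0" and le: "\<And>n. norm (y n) \<le> norm (x n)"
  have "y \<longlonglongrightarrow> 0" using x le Lim_null_comparison[of y "\<lambda>n. norm (x n)" sequentially]
    by (auto simp: c0_def tendsto_norm_zero_iff)
  moreover have "nrm c0 y \<le> nrm c0 x"
    by (rule c0_nrm_le) (use le c0_norm_le_nrm[OF x] order_trans in blast)
  ultimately show "y \<in> vecs c0 \<and> nrm c0 y \<le> nrm c0 x" by (simp add: c0_def)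
next
  fix x assume x: "x \<in> vecs c0"
  show "(\<lambda>n. x (Suc n)) \<in> vecs c0 \<and> nrm c0 (\<lambda>n. x (Suc n)) \<le> nrm c0 x"
    using x c0_nrm_le[of "\<lambda>n. x (Suc n)", OF c0_norm_le_nrm[OF x]]
    by (simp add: c0_def LIMSEQ_Suc)
  have "case_nat 0 x \<longlonglongrightarrow> 0"
    by (rule LIMSEQ_imp_Suc) (use x in \<open>simp add: c0_def\<close>)
  moreover have "nrm c0 (case_nat 0 x) \<le> nrm c0 x"
  proof (rule c0_nrm_le)
    fix n show "norm (case_nat 0 x n) \<le> nrm c0 x"
      using c0_norm_le_nrm[OF x] order_trans[OF norm_ge_zero c0_norm_le_nrm[OF x]] by (cases n) auto
  qed
  ultimately show "case_nat 0 x \<in> vecs c0 \<and> nrm c0 (case_nat 0 x) \<le> nrm c0 x" by (simp add: c0_def)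
qed (rule c0_norm_le_nrm c0_geometric_conv, assumption+)+

section \<open>Consequences of the axioms of \<open>seq_space\<close>\<close>

context seq_space
begin

lemma nrm_nonneg: "x \<in> vecs S \<Longrightarrow> 0 \<le> nrm S x"
  using norm_le_nrm[of x 0] norm_ge_zero order_trans by blast

lemma minus_mem: "x \<in> vecs S \<Longrightarrow> y \<in> vecs S \<Longrightarrow> x - y \<in> vecs S"
  using add_mem[of x "fscale (-1) y"] scale_mem[of y "-1"]
  by (simp add: fscale_def plus_fun_def fun_diff_def)

lemma nrm_zero: "nrm S 0 = 0"
  using nrm_scale[OF zero_mem, of 0] by (simp add: fscale_def zero_fun_def)

lemma nrm_eq_0: "x \<in> vecs S \<Longrightarrow> nrm S x = 0 \<Longrightarrow> x = 0"
  using norm_le_nrm[of x] by fastforce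

text \<open>Symmetry of the distance is demanded on the whole type, also where \<open>nrm S\<close>
  has no meaning; this is why \<open>nrm_cong\<close> carries no membership assumption.\<close>

lemma Metric_space_nrm: "Metric_space (vecs S) (\<lambda>x y. \<bar>nrm S (x - y)\<bar>)"
proof
  fix x y :: "nat \<Rightarrow> complex"
  show "\<bar>nrm S (x - y)\<bar> = \<bar>nrm S (y - x)\<bar>"
    by (rule arg_cong[where f = abs], rule nrm_cong) (simp add: norm_minus_commute)
next
  fix x y assume "x \<in> vecs S" "y \<in> vecs S"
  then show "(\<bar>nrm S (x - y)\<bar> = 0) = (x = y)"
    using nrm_eq_0[OF minus_mem[of x y]] nrm_zero by auto
next
  fix x y z assume "x \<in> vecs S" "y \<in> vecs S" "z \<in> vecs S"
  then show "\<bar>nrm S (x - z)\<bar> \<le> \<bar>nrm S (x - y)\<bar> + \<bar>nrm S (y - z)\<bar>"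
    using triangle[of "x - y" "y - z"] minus_mem nrm_nonneg by simp
qed simp

lemma compact_op_zero: "compact_op S S (\<lambda>x. 0)"
proof -
  interpret Metric_space "vecs S" "\<lambda>x y. \<bar>nrm S (x - y)\<bar>" by (rule Metric_space_nrm)
  have "(\<lambda>x. 0) ` {x \<in> vecs S. nrm S x \<le> 1} = {0 :: nat \<Rightarrow> complex}"
    using zero_mem nrm_zero by force
  moreover have "closedin mtopology {0}"
    by (rule closedin_Hausdorff_singleton[OF Hausdorff_space_mtopology]) (simp add: zero_mem)
  moreover have "bounded_op S S (\<lambda>x. 0)"
    unfolding bounded_op_def using zero_mem nrm_zero
    by (auto simp: fscale_def zero_fun_def intro!: exI[of _ 0])
  ultimately show ?thesis
    by (simp add: compact_op_def norm_topology_def closure_of_closedin finite_imp_compactin zero_mem)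
qed

lemma solid_scaled:
  assumes "x \<in> vecs S" "0 \<le> C" "\<And>n. norm (y n) \<le> C * norm (x n)"
  shows "y \<in> vecs S \<and> nrm S y \<le> C * nrm S x"
  using solid[OF scale_mem[OF assms(1), of "of_real C"], of y] nrm_scale[OF assms(1), of "of_real C"] assms
  by (simp add: fscale_def norm_mult)

lemma bounded_op_seq_shift:
  assumes "\<And>n. norm (\<alpha> (Suc n)) \<le> C"
  shows "bounded_op S S (seq_shift \<alpha>)"
proof -
  have C: "0 \<le> C" using assms[of 0] norm_ge_zero order_trans by blast
  have b: "seq_shift \<alpha> x \<in> vecs S \<and> nrm S (seq_shift \<alpha> x) \<le> C * nrm S x" if x: "x \<in> vecs S" for x
  proof -
    have "seq_shift \<alpha> x \<in> vecs S \<and> nrm S (seq_shift \<alpha> x) \<le> C * nrm S (\<lambda>n. x (Suc n))"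
      using left_shift[OF x] assms C
      by (intro solid_scaled) (auto simp: seq_shift_def norm_mult intro!: mult_right_mono)
    then show ?thesis using mult_left_mono[OF conjunct2[OF left_shift[OF x]] C] by linarith
  qed
  then show ?thesis
    unfolding bounded_op_def
    by (auto simp: seq_shift_def fscale_def plus_fun_def algebra_simps)
qed

end

section \<open>Bidiagonal operators: the identity plus a weighted right shift\<close>

definition bidiag :: "(nat \<Rightarrow> complex) \<Rightarrow> (nat \<Rightarrow> complex) \<Rightarrow> (nat \<Rightarrow> complex)" where
  "bidiag \<beta> l = (\<lambda>n. l n + \<beta> n * case_nat 0 l n)"

lemma inj_bidiag: "inj (bidiag \<beta>)"
proof (rule injI)
  fix l m assume eq: "bidiag \<beta> l = bidiag \<beta> m"
  have "l n = m n" for n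
  proof (induction n)
    case 0 show ?case using fun_cong[OF eq, of 0] by (simp add: bidiag_def)
  next
    case (Suc n) then show ?case using fun_cong[OF eq, of "Suc n"] by (simp add: bidiag_def)
  qed
  then show "l = m" by (rule ext)
qed

context seq_space
begin

lemma bidiag_bounded:
  assumes "x \<in> vecs S" "0 \<le> C" "\<And>n. norm (\<beta> n) \<le> C"
  shows "bidiag \<beta> x \<in> vecs S \<and> nrm S (bidiag \<beta> x) \<le> (1 + C) * nrm S x"
proof -
  let ?r = "\<lambda>n. \<beta> n * case_nat 0 x n"
  have "?r \<in> vecs S \<and> nrm S ?r \<le> C * nrm S (case_nat 0 x)"
    using assms right_shift[OF assms(1)]
    by (intro solid_scaled) (auto simp: norm_mult intro!: mult_right_mono)
  moreover have "bidiag \<beta> x = x + ?r" by (simp add: bidiag_def plus_fun_def)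
  moreover have "C * nrm S (case_nat 0 x) \<le> C * nrm S x"
    using right_shift[OF assms(1)] assms by (intro mult_left_mono) auto
  ultimately show ?thesis using add_mem triangle[of x ?r] assms by (auto simp: algebra_simps)
qed

text \<open>The subdiagonal may exceed \<open>1\<close> at finitely many places. Rescaling by the weights \<open>g\<close>,
  which are constant from \<open>N\<close> on, turns it into a subdiagonal bounded by \<open>\<theta>\<close>.\<close>

lemma bidiag_inverse_bounded:
  assumes \<theta>: "0 < \<theta>" "\<theta> < 1" and \<beta>: "\<And>n. N \<le> n \<Longrightarrow> norm (\<beta> n) \<le> \<theta>"
  shows "\<exists>K. \<forall>y\<in>vecs S. \<exists>l\<in>vecs S. bidiag \<beta> l = y \<and> nrm S l \<le> K * nrm S y"
proof -
  \<comment> \<open>The factor is 1 where \<open>norm (\<beta> i) \<le> \<theta>\<close> and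
    otherwise shrinks the entry just enough. As \<open>g (Suc n)\<close> contains
    \<open>\<gamma> (Suc n)\<close>, the sequence \<open>g n * norm (l n)\<close> obeys a recursion
    with factor \<open>\<theta>\<close>.\<close>
  define \<gamma> where "\<gamma> i = \<theta> / max \<theta> (norm (\<beta> i))" for i
  define g where "g n = (\<Prod>i\<le>n. \<gamma> i)" for n
  have \<gamma>: "0 < \<gamma> i" "\<gamma> i \<le> 1" "\<gamma> i * norm (\<beta> i) \<le> \<theta>" for i
  proof -
    have m: "0 < max \<theta> (norm (\<beta> i))" using \<theta> by linarith
    show "0 < \<gamma> i" "\<gamma> i \<le> 1" using m \<theta> by (simp_all add: \<gamma>_def)
    have "\<theta> * norm (\<beta> i) \<le> \<theta> * max \<theta> (norm (\<beta> i))" using \<theta> by (intro mult_left_mono) auto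
    then show "\<gamma> i * norm (\<beta> i) \<le> \<theta>" using m by (simp add: \<gamma>_def divide_le_eq)
  qed
  have \<gamma>1: "\<gamma> i = 1" if "N \<le> i" for i using \<beta>[OF that] \<theta> by (simp add: \<gamma>_def max_def)
  have g0: "0 < g n" for n unfolding g_def using \<gamma> by (simp add: prod_pos)
  have gS: "g (Suc n) = g n * \<gamma> (Suc n)" for n by (simp add: g_def)
  have g1: "g n \<le> 1" for n unfolding g_def using \<gamma> by (intro prod_le_1) (auto intro: less_imp_le)
  \<comment> \<open>\<open>g\<close> decreases up to \<open>N\<close> and is constant afterwards, so
    \<open>g N\<close> is its minimum; undoing the rescaling costs the factor
    \<open>1 / g N\<close>.\<close>
  have gN: "g N \<le> g n" for n
  proof (cases "n \<le> N")
    case True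
    have "g (n + k) \<le> g n" for k
    proof (induction k)
      case (Suc k)
      have "g (n + Suc k) \<le> g (n + k)" using gS[of "n + k"] \<gamma>(2) g0[of "n + k"] by (simp add: mult_left_le)
      then show ?case using Suc by simp
    qed simp
    from this[of "N - n"] show ?thesis using True by simp
  next
    case False
    have "g (N + k) = g N" for k by (induction k) (simp_all add: gS \<gamma>1)
    from this[of "n - N"] show ?thesis using False by simp
  qed
  show ?thesis
  proof (intro exI[of _ "1 / g N * (1 / (1 - \<theta>))"] ballI)
    fix y assume y: "y \<in> vecs S"
    define l where "l = rec_nat (y 0) (\<lambda>n t. y (Suc n) - \<beta> (Suc n) * t)"
    have l: "l 0 = y 0" "\<And>n. l (Suc n) = y (Suc n) - \<beta> (Suc n) * l n" by (simp_all add: l_def)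
    \<comment> \<open>The geometric convolution of \<open>norm (y n)\<close>, a majorant for the
      rescaled solution of the forward substitution \<open>l\<close>.\<close>
    define z where "z = rec_nat (norm (y 0)) (\<lambda>n t. \<theta> * t + norm (y (Suc n)))"
    have z: "z 0 = norm (y 0)" "\<And>n. z (Suc n) = \<theta> * z n + norm (y (Suc n))" by (simp_all add: z_def)
    have z_nonneg: "0 \<le> z n" for n by (induction n) (use z \<theta> in auto)
    have le: "g n * norm (l n) \<le> z n" for n
    proof (induction n)
      case 0 show ?case using l z g0[of 0] g1[of 0] by (simp add: mult_left_le_one_le)
    next
      case (Suc n)
      have "g (Suc n) * norm (l (Suc n)) \<le> g (Suc n) * norm (y (Suc n)) + g (Suc n) * (norm (\<beta> (Suc n)) * norm (l n))"
        using mult_left_mono[OF norm_triangle_ineq4[of "y (Suc n)" "\<beta> (Suc n) * l n"], of "g (Suc n)"] g0[of "Suc n"]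
        by (simp add: l norm_mult distrib_left)
      also have "g (Suc n) * (norm (\<beta> (Suc n)) * norm (l n)) = (\<gamma> (Suc n) * norm (\<beta> (Suc n))) * (g n * norm (l n))"
        by (simp add: gS)
      also have "\<dots> \<le> \<theta> * z n" using \<gamma>(1)[of "Suc n"] \<gamma>(3)[of "Suc n"] Suc g0[of n] \<theta>
        by (intro mult_mono) auto
      also have "g (Suc n) * norm (y (Suc n)) \<le> norm (y (Suc n))"
        using g0[of "Suc n"] g1[of "Suc n"] by (simp add: mult_left_le_one_le)
      finally show ?case by (simp add: z)
    qed
    have zm: "(\<lambda>n. of_real (z n)) \<in> vecs S \<and> nrm S (\<lambda>n. of_real (z n)) \<le> nrm S y / (1 - \<theta>)"
      by (rule geometric_conv[OF y]) (use \<theta> z_nonneg in \<open>simp_all add: z(1) flip: z(2)\<close>)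
    have "norm (l n) \<le> 1 / g N * norm (complex_of_real (z n))" for n
    proof -
      have "g N * norm (l n) \<le> z n" using le[of n] gN[of n] mult_right_mono[OF gN[of n], of "norm (l n)"] by simp
      then show ?thesis using g0[of N] z_nonneg by (simp add: field_simps)
    qed
    then have "l \<in> vecs S \<and> nrm S l \<le> 1 / g N * nrm S (\<lambda>n. of_real (z n))"
      using zm g0[of N] by (intro solid_scaled) (auto intro: less_imp_le)
    moreover have "1 / g N * nrm S (\<lambda>n. of_real (z n)) \<le> 1 / g N * (nrm S y / (1 - \<theta>))"
      using zm g0[of N] by (intro mult_left_mono) (auto intro: less_imp_le)
    moreover have "bidiag \<beta> l = y"
    proof
      fix n show "bidiag \<beta> l n = y n" by (cases n) (simp_all add: bidiag_def l)
    qed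
    ultimately show "\<exists>l\<in>vecs S. bidiag \<beta> l = y \<and> nrm S l \<le> 1 / g N * (1 / (1 - \<theta>)) * nrm S y"
      by (intro bexI[of _ l]) auto
  qed
qed

end

section \<open>Taylor coefficients\<close>

definition taylor_fun :: "(nat \<Rightarrow> complex) \<Rightarrow> (complex \<Rightarrow> complex)" where
  "taylor_fun t = (\<lambda>z. if z \<in> ball 0 1 then eval_fps (Abs_fps t) z else 0)"

definition taylor_coeff :: "(complex \<Rightarrow> complex) \<Rightarrow> (nat \<Rightarrow> complex)" where
  "taylor_coeff f n = fps_nth (fps_expansion f 0) n"

lemma taylor_coeff_taylor_fun:
  assumes "fps_conv_radius (Abs_fps t) \<ge> 1"
  shows "taylor_coeff (taylor_fun t) = t"
proof -
  have "taylor_fun t has_fps_expansion Abs_fps t"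
    unfolding has_fps_expansion_def
  proof
    show "0 < fps_conv_radius (Abs_fps t)" by (rule less_le_trans[OF _ assms]) simp
    have "eventually (\<lambda>z. z \<in> ball 0 1) (nhds (0::complex))"
      by (rule eventually_nhds_in_open) auto
    then show "\<forall>\<^sub>F z in nhds 0. eval_fps (Abs_fps t) z = taylor_fun t z"
      by eventually_elim (simp add: taylor_fun_def)
  qed
  from fps_expansion_eqI[OF this] show ?thesis by (auto simp: taylor_coeff_def)
qed

lemma taylor_fun_holomorphic:
  assumes "fps_conv_radius (Abs_fps t) \<ge> 1"
  shows "taylor_fun t holomorphic_on ball 0 1"
proof -
  have "eval_fps (Abs_fps t) holomorphic_on ball 0 1"
  proof (rule holomorphic_on_eval_fps, rule subsetI)
    fix z :: complex assume "z \<in> ball 0 1"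
    then have "ereal (norm z) < 1" by simp
    also note assms
    finally show "z \<in> eball 0 (fps_conv_radius (Abs_fps t))" by simp
  qed
  then show ?thesis by (rule holomorphic_transform) (simp add: taylor_fun_def)
qed

lemma taylor_fun_sums:
  assumes "fps_conv_radius (Abs_fps t) \<ge> 1" "norm z < 1"
  shows "(\<lambda>n. t n * z ^ n) sums taylor_fun t z"
proof -
  have "ereal (norm z) < 1" using assms by simp
  also note assms(1)
  finally have "ereal (norm z) < fps_conv_radius (Abs_fps t)" .
  from sums_eval_fps[OF this] show ?thesis using assms by (simp add: taylor_fun_def)
qed

lemma disc_shift_eq: "disc_shift w f = taylor_fun (\<lambda>n. w (Suc n) * taylor_coeff f (Suc n))"
  by (simp add: disc_shift_def taylor_fun_def taylor_coeff_def)

text \<open>Boundedness at radius \<open>s = (1 + r) / 2\<close> leaves the factor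
  \<open>(r / s) ^ n\<close> at radius \<open>r\<close>, hence a convergent geometric majorant.
  Bounded \<open>u\<close> are enough, so every space satisfying \<open>norm_le_nrm\<close> is
  covered.\<close>

lemma conv_radius_ge_1_of_growth:
  fixes c u :: "nat \<Rightarrow> complex"
  assumes "\<And>r. 0 < r \<Longrightarrow> r < 1 \<Longrightarrow> bdd_above (range (\<lambda>n. norm (c n) * r ^ n))"
    and "\<And>n. norm (u n) \<le> M"
  shows "fps_conv_radius (Abs_fps (\<lambda>n. c n * u n)) \<ge> 1"
  unfolding fps_conv_radius_def
proof (rule conv_radius_geI_ex')
  fix r :: real assume r: "0 < r" "ereal r < 1"
  define s where "s = (1 + r) / 2"
  have s: "0 < s" "r < s" "s < 1" using r by (auto simp: s_def)
  obtain C where C: "\<And>n. norm (c n) * s ^ n \<le> C" using assms(1)[OF s(1,3)] by (auto simp: bdd_above_def)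
  have M: "0 \<le> M" using assms(2)[of 0] norm_ge_zero order_trans by blast
  show "summable (\<lambda>n. fps_nth (Abs_fps (\<lambda>n. c n * u n)) n * complex_of_real r ^ n)"
  proof (rule summable_comparison_test'[where N = 0])
    show "summable (\<lambda>n. C * M * (r / s) ^ n)" using r s by (intro summable_mult summable_geometric) auto
    fix n
    have "norm (c n) * norm (u n) * r ^ n = (norm (c n) * s ^ n) * norm (u n) * (r / s) ^ n"
      using s by (simp add: power_divide)
    also have "\<dots> \<le> C * M * (r / s) ^ n"
      using C[of n] assms(2)[of n] r s M order_trans[OF _ C[of n]]
      by (intro mult_right_mono mult_mono) auto
    finally show "norm (fps_nth (Abs_fps (\<lambda>n. c n * u n)) n * complex_of_real r ^ n) \<le> C * M * (r / s) ^ n"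
      using r by (simp add: norm_mult norm_power)
  qed
qed

section \<open>Transport along isomorphisms\<close>

lemma bounded_op_compose:
  assumes F: "bounded_op X Y F" and G: "bounded_op Y Z G"
    and Y: "\<And>y. y \<in> vecs Y \<Longrightarrow> 0 \<le> nrm Y y"
  shows "bounded_op X Z (\<lambda>x. G (F x))"
proof -
  obtain C D where C: "\<And>x. x \<in> vecs X \<Longrightarrow> nrm Y (F x) \<le> C * nrm X x"
    and D: "\<And>y. y \<in> vecs Y \<Longrightarrow> nrm Z (G y) \<le> D * nrm Y y"
    using F G unfolding bounded_op_def by metis
  have "nrm Z (G (F x)) \<le> (\<bar>D\<bar> * C) * nrm X x" if x: "x \<in> vecs X" for x
  proof -
    have Fx: "F x \<in> vecs Y" using F x by (simp add: bounded_op_def)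
    have "nrm Z (G (F x)) \<le> \<bar>D\<bar> * nrm Y (F x)"
      using D[OF Fx] mult_right_mono[OF abs_ge_self[of D] Y[OF Fx]] by linarith
    also have "\<dots> \<le> \<bar>D\<bar> * (C * nrm X x)" using C[OF x] by (intro mult_left_mono) auto
    finally show ?thesis by simp
  qed
  then show ?thesis using F G unfolding bounded_op_def by auto
qed

lemma bounded_op_0:
  assumes "bounded_op X Y F" "0 \<in> vecs X"
  shows "F 0 = 0"
proof -
  have "F (fscale 0 0) = fscale 0 (F 0)" using assms unfolding bounded_op_def by blast
  then show ?thesis by (simp add: fscale_def zero_fun_def)
qed

text \<open>Only \<open>Y\<close> is assumed to be closed under the vector operations, and only
  \<open>J\<close> to be linear; both properties pass to \<open>X\<close> and \<open>U\<close>
  through the bijection. This suits \<open>disc_space\<close>, whose carrier is given by the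
  existence of expansions.\<close>

locale space_iso =
  fixes X :: "'i fun_space" and Y :: "'j fun_space"
    and J :: "('j \<Rightarrow> complex) \<Rightarrow> ('i \<Rightarrow> complex)" and U :: "('i \<Rightarrow> complex) \<Rightarrow> ('j \<Rightarrow> complex)"
  assumes zero_Y: "0 \<in> vecs Y"
    and add_Y: "u \<in> vecs Y \<Longrightarrow> v \<in> vecs Y \<Longrightarrow> u + v \<in> vecs Y"
    and scale_Y: "u \<in> vecs Y \<Longrightarrow> fscale c u \<in> vecs Y"
    and nrm_Y: "u \<in> vecs Y \<Longrightarrow> 0 \<le> nrm Y u"
    and J_mem: "u \<in> vecs Y \<Longrightarrow> J u \<in> vecs X" and UJ: "u \<in> vecs Y \<Longrightarrow> U (J u) = u"
    and U_mem: "x \<in> vecs X \<Longrightarrow> U x \<in> vecs Y" and JU: "x \<in> vecs X \<Longrightarrow> J (U x) = x"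
    and J_add: "u \<in> vecs Y \<Longrightarrow> v \<in> vecs Y \<Longrightarrow> J (u + v) = J u + J v"
    and J_scale: "u \<in> vecs Y \<Longrightarrow> J (fscale c u) = fscale c (J u)"
    and J_bounded: "\<exists>C. \<forall>u\<in>vecs Y. nrm X (J u) \<le> C * nrm Y u"
    and U_bounded: "\<exists>C. \<forall>x\<in>vecs X. nrm Y (U x) \<le> C * nrm X x"
begin

lemma add_X:
  assumes "x \<in> vecs X" "y \<in> vecs X"
  shows "x + y \<in> vecs X" "U (x + y) = U x + U y"
proof -
  have "x + y = J (U x + U y)" using assms by (simp add: J_add U_mem JU)
  then show "x + y \<in> vecs X" "U (x + y) = U x + U y" using assms by (simp_all add: J_mem U_mem add_Y UJ)
qed

lemma scale_X:
  assumes "x \<in> vecs X"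
  shows "fscale c x \<in> vecs X" "U (fscale c x) = fscale c (U x)"
proof -
  have "fscale c x = J (fscale c (U x))" using assms by (simp add: J_scale U_mem JU)
  then show "fscale c x \<in> vecs X" "U (fscale c x) = fscale c (U x)" using assms by (simp_all add: J_mem U_mem scale_Y UJ)
qed

lemma J_zero: "J 0 = 0"
  using J_scale[OF zero_Y, of 0] by (simp add: fscale_def zero_fun_def)

lemma bounded_op_J: "bounded_op Y X J"
  using J_mem J_add J_scale J_bounded by (simp add: bounded_op_def)

lemma bounded_op_U: "bounded_op X Y U"
  using U_mem add_X scale_X U_bounded by (simp add: bounded_op_def)

lemma bounded_op_conjugate:
  assumes R: "bounded_op Y Y R" and T: "\<And>u. u \<in> vecs Y \<Longrightarrow> T (J u) = J (R u)"
  shows "bounded_op X X T"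
proof -
  have eq: "T x = J (R (U x))" if "x \<in> vecs X" for x using T[of "U x"] that by (simp add: U_mem JU)
  have "bounded_op X X (\<lambda>x. J (R (U x)))"
    by (rule bounded_op_compose[OF bounded_op_compose[OF bounded_op_U R] bounded_op_J]) (auto intro: nrm_Y)
  then show ?thesis using add_X scale_X by (simp add: bounded_op_def eq)
qed

lemma similar_conjugate:
  assumes R: "bounded_op Y Y R" and T: "\<And>u. u \<in> vecs Y \<Longrightarrow> T (J u) = J (R u)"
  shows "similar X T Y R"
  unfolding similar_def
proof (intro conjI exI[of _ U] ballI)
  show bij: "bij_betw U (vecs X) (vecs Y)"
    by (rule bij_betw_byWitness[where f' = J]) (use J_mem U_mem JU UJ in auto)
  \<comment> \<open>\<open>similar\<close> is phrased with \<open>inv_into\<close>, which agrees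
    with \<open>J\<close> on the carrier of \<open>Y\<close> only.\<close>
  have inv: "inv_into (vecs X) U y = J y" if "y \<in> vecs Y" for y
    using that bij inv_into_f_f[of U "vecs X" "J y"] by (simp add: bij_betw_def J_mem UJ)
  show "bounded_op X X T" by (rule bounded_op_conjugate[OF R T])
  show "bounded_op Y X (inv_into (vecs X) U)"
    using bounded_op_J add_Y scale_Y by (simp add: bounded_op_def inv)
  fix y assume y: "y \<in> vecs Y"
  then show "R y = U (T (inv_into (vecs X) U y))" using R by (simp add: inv T UJ bounded_op_def)
qed (use R bounded_op_U in auto)

text \<open>The kernel is spanned by any one of its non-zero elements. With full range there is a
  single coset, so the empty set serves as basis of the quotient.\<close>

lemma fredholm_if_surj:
  assumes R: "bounded_op Y Y R" and T: "\<And>u. u \<in> vecs Y \<Longrightarrow> T (J u) = J (R u)"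
    and surj: "\<And>v. v \<in> vecs Y \<Longrightarrow> \<exists>u\<in>vecs Y. R u = v"
    and ker: "\<And>u v. u \<in> vecs Y \<Longrightarrow> v \<in> vecs Y \<Longrightarrow> R u = 0 \<Longrightarrow> R v = 0 \<Longrightarrow> u \<noteq> 0 \<Longrightarrow> \<exists>c. v = fscale c u"
  shows "fredholm X T"
  unfolding fredholm_def
proof (intro conjI)
  show bT: "bounded_op X X T" by (rule bounded_op_conjugate[OF R T])
  have R0: "R (U x) = 0" if "x \<in> vecs X" "T x = 0" for x
  proof -
    have "J (R (U x)) = J 0" using that T[of "U x"] by (simp add: U_mem JU J_zero)
    then show ?thesis using R that UJ zero_Y U_mem by (metis bounded_op_def)
  qed
  show "finite_dim {x \<in> vecs X. T x = 0}"
  proof (cases "\<exists>x\<in>vecs X. T x = 0 \<and> x \<noteq> 0")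
    case False
    have "0 \<in> vecs X" "T 0 = 0"
      using J_mem[OF zero_Y] T[OF zero_Y] bounded_op_0[OF R zero_Y] by (simp_all only: J_zero)
    then have "{x \<in> vecs X. T x = 0} = fvs.span {}" using False by auto
    then show ?thesis unfolding finite_dim_def by (intro exI[of _ "{}"]) auto
  next
    case True
    then obtain x0 where x0: "x0 \<in> vecs X" "T x0 = 0" "x0 \<noteq> 0" by auto
    have U0: "U x0 \<noteq> 0" using x0 JU J_zero by metis
    have "x \<in> fvs.span {x0}" if x: "x \<in> vecs X" "T x = 0" for x
    proof -
      obtain c where "U x = fscale c (U x0)"
        using ker[OF U_mem[OF x0(1)] U_mem[OF x(1)] R0[OF x0(1,2)] R0[OF x] U0] by blast
      then have "x = fscale c x0" using JU x x0 J_scale U_mem by metis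
      then show ?thesis by (auto simp: fvs.span_singleton)
    qed
    moreover have "fscale c x0 \<in> vecs X \<and> T (fscale c x0) = 0" for c
      using bT x0 scale_X by (simp add: bounded_op_def)
    ultimately have "{x \<in> vecs X. T x = 0} = fvs.span {x0}" by (auto simp: fvs.span_singleton)
    then show ?thesis unfolding finite_dim_def using x0 by (intro exI[of _ "{x0}"]) auto
  qed
  have "T ` vecs X = vecs X"
  proof
    show "T ` vecs X \<subseteq> vecs X" using bT by (auto simp: bounded_op_def)
    show "vecs X \<subseteq> T ` vecs X"
    proof
      fix x assume x: "x \<in> vecs X"
      obtain u where "u \<in> vecs Y" "R u = U x" using surj U_mem x by metis
      then have "T (J u) = x" "J u \<in> vecs X" using T J_mem JU x by auto
      then show "x \<in> T ` vecs X" by (metis imageI)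
    qed
  qed
  moreover have "coset (vecs X) x = vecs X" if x: "x \<in> vecs X" for x
  proof
    show "coset (vecs X) x \<subseteq> vecs X" using x add_X by (auto simp: coset_def)
    show "vecs X \<subseteq> coset (vecs X) x"
    proof
      fix y assume y: "y \<in> vecs X"
      then have "y + fscale (-1) x \<in> vecs X" by (rule add_X(1)[OF _ scale_X(1)[OF x]])
      moreover have "y = x + (y + fscale (-1) x)" by (auto simp: fscale_def)
      ultimately show "y \<in> coset (vecs X) x" unfolding coset_def by blast
    qed
  qed
  moreover have "0 \<in> vecs X" using J_mem[OF zero_Y] by (simp add: J_zero)
  ultimately show "finite_dim_quotient (vecs X) (T ` vecs X)"
    unfolding finite_dim_quotient_def by (intro exI[of _ "{}"]) auto
qed

text \<open>This extracts from the Fredholm property the only part that the negative result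
  contradicts. The set \<open>B\<close> is the image under \<open>U\<close> of representatives of a
  spanning set of the quotient; neither independence nor a closed range enters.\<close>

lemma fredholm_finite_codim:
  assumes R: "bounded_op Y Y R" and T: "\<And>u. u \<in> vecs Y \<Longrightarrow> T (J u) = J (R u)"
    and fr: "fredholm X T"
  obtains B where "finite B" "\<And>v. v \<in> vecs Y \<Longrightarrow> \<exists>u\<in>vecs Y. v - R u \<in> fvs.span B"
proof -
  obtain B where B: "finite B" "B \<subseteq> vecs X" "coset (T ` vecs X) ` vecs X = coset (T ` vecs X) ` fvs.span B"
    using fr by (auto simp: fredholm_def finite_dim_quotient_def)
  have X0: "0 \<in> vecs X" using J_mem[OF zero_Y] by (simp add: J_zero)
  have span: "s \<in> vecs X \<and> U s \<in> fvs.span (U ` B)" if "s \<in> fvs.span B" for s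
    using that
  proof (induction rule: fvs.span_induct_alt)
    case base
    have "U 0 = 0" using UJ[OF zero_Y] by (simp add: J_zero)
    then show ?case using X0 fvs.span_zero by metis
  next
    case (step c x y)
    then have x: "x \<in> vecs X" using B(2) by auto
    have "U x \<in> fvs.span (U ` B)" using step by (intro fvs.span_base) simp
    then have "fscale c (U x) + U y \<in> fvs.span (U ` B)"
      using step by (intro fvs.span_add fvs.span_scale) auto
    then show ?case
      using step add_X[OF scale_X(1)[OF x, of c], of y] scale_X(2)[OF x, of c] by metis
  qed
  have "\<exists>u\<in>vecs Y. v - R u \<in> fvs.span (U ` B)" if v: "v \<in> vecs Y" for v
  proof -
    have "coset (T ` vecs X) (J v) \<in> coset (T ` vecs X) ` fvs.span B" using B(3) J_mem[OF v] by blast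
    then obtain s where s: "s \<in> fvs.span B" "coset (T ` vecs X) (J v) = coset (T ` vecs X) s" by auto
    have "T 0 = 0" using fr X0 bounded_op_0 unfolding fredholm_def by blast
    \<comment> \<open>Equality of the two cosets is used through one element: \<open>J v\<close>
      lies in its own coset because \<open>T 0 = 0\<close>.\<close>
    then have "J v + 0 \<in> coset (T ` vecs X) (J v)" using X0 unfolding coset_def by force
    then obtain x where x: "x \<in> vecs X" "J v = s + T x" using s(2) unfolding coset_def by auto
    have "T x = J (R (U x))" using T[of "U x"] x by (simp add: U_mem JU)
    moreover have Rx: "R (U x) \<in> vecs Y" using R U_mem[OF x(1)] by (simp add: bounded_op_def)
    ultimately have "v = U s + R (U x)"
      using x(2) UJ[OF v] add_X(2)[of s "T x"] span[OF s(1)] J_mem UJ by metis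
    then have "v - R (U x) = U s" by simp
    then show ?thesis using span[OF s(1)] U_mem[OF x(1)] by metis
  qed
  then show ?thesis using that[of "U ` B"] B(1) by blast
qed

end

section \<open>The spaces on the disc\<close>

text \<open>\<open>growth\<close> is the common consequence of the three conditions on the natural
  domain: summability and boundedness at a radius below 1 both yield it. The pair
  \<open>\<theta>\<close>, \<open>N\<close> spells out the limsup condition.\<close>

locale disc_basis = seq_space +
  fixes a b :: "nat \<Rightarrow> complex" and \<theta> :: real and N :: nat
  assumes a_nz: "a n \<noteq> 0"
    and growth: "0 < r \<Longrightarrow> r < 1 \<Longrightarrow> bdd_above (range (\<lambda>n. (norm (a n) + norm (b n)) * r ^ n))"
    and \<theta>: "0 < \<theta>" "\<theta> < 1" and ratio: "N \<le> n \<Longrightarrow> norm (b n / a (Suc n)) \<le> \<theta>"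
begin

definition \<beta> :: "nat \<Rightarrow> complex" where
  "\<beta> n = (case n of 0 \<Rightarrow> 0 | Suc m \<Rightarrow> b m / a (Suc m))"

definition J :: "(nat \<Rightarrow> complex) \<Rightarrow> (complex \<Rightarrow> complex)" where
  "J u = taylor_fun (\<lambda>n. a n * u n)"

definition U :: "(complex \<Rightarrow> complex) \<Rightarrow> (nat \<Rightarrow> complex)" where
  "U f = (\<lambda>n. taylor_coeff f n / a n)"

lemma growth_a: "0 < r \<Longrightarrow> r < 1 \<Longrightarrow> bdd_above (range (\<lambda>n. norm (a n) * r ^ n))"
  and growth_b: "0 < r \<Longrightarrow> r < 1 \<Longrightarrow> bdd_above (range (\<lambda>n. norm (b n) * r ^ n))"
proof -
  assume r: "0 < r" "r < 1"
  then obtain M where M: "\<And>n. (norm (a n) + norm (b n)) * r ^ n \<le> M"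
    using growth[OF r] by (auto simp: bdd_above_def)
  have "norm (a n) * r ^ n \<le> M" "norm (b n) * r ^ n \<le> M" for n
    using r by (auto intro!: order_trans[OF _ M[of n]] mult_right_mono)
  then show "bdd_above (range (\<lambda>n. norm (a n) * r ^ n))"
    and "bdd_above (range (\<lambda>n. norm (b n) * r ^ n))"
    by - (rule bdd_aboveI2, blast)+
qed

lemma conv_radius_a: "u \<in> vecs S \<Longrightarrow> fps_conv_radius (Abs_fps (\<lambda>n. a n * u n)) \<ge> 1"
  using conv_radius_ge_1_of_growth[OF growth_a norm_le_nrm] .

lemma conv_radius_b: "u \<in> vecs S \<Longrightarrow> fps_conv_radius (Abs_fps (\<lambda>n. b n * u n)) \<ge> 1"
  using conv_radius_ge_1_of_growth[OF growth_b norm_le_nrm] .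

lemma U_J: "u \<in> vecs S \<Longrightarrow> U (J u) = u"
  unfolding U_def J_def using taylor_coeff_taylor_fun[OF conv_radius_a, of u] a_nz by simp

lemma J_zero_outside: "z \<notin> ball 0 1 \<Longrightarrow> J u z = 0"
  by (simp add: J_def taylor_fun_def)

lemma a_bidiag: "a n * bidiag \<beta> l n = a n * l n + case_nat 0 (\<lambda>m. b m * l m) n"
  using a_nz by (cases n) (simp_all add: bidiag_def \<beta>_def distrib_left)

lemma bidiag_mem: "\<exists>C. \<forall>l\<in>vecs S. bidiag \<beta> l \<in> vecs S \<and> nrm S (bidiag \<beta> l) \<le> C * nrm S l"
proof -
  define C where "C = \<theta> + (\<Sum>m\<le>N. norm (\<beta> m))"
  have "norm (\<beta> n) \<le> C" for n
  proof (cases "n \<le> N")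
    case True
    then show ?thesis using \<theta> member_le_sum[of n "{..N}" "\<lambda>m. norm (\<beta> m)"] by (simp add: C_def)
  next
    case False
    then have "norm (\<beta> n) \<le> \<theta>" using ratio by (cases n) (auto simp: \<beta>_def)
    then show ?thesis by (simp add: C_def sum_nonneg add_increasing2)
  qed
  moreover have "0 \<le> C" using \<theta> by (simp add: C_def sum_nonneg)
  ultimately show ?thesis using bidiag_bounded by blast
qed

lemma bidiag_inverse: "\<exists>K. \<forall>u\<in>vecs S. \<exists>l\<in>vecs S. bidiag \<beta> l = u \<and> nrm S l \<le> K * nrm S u"
proof (rule bidiag_inverse_bounded[OF \<theta>, of "Suc N"])
  fix n assume "Suc N \<le> n"
  then show "norm (\<beta> n) \<le> \<theta>" using ratio by (cases n) (auto simp: \<beta>_def)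
qed

text \<open>The series of the \<open>a n * l n * z ^ n\<close> and of the
  \<open>b n * l n * z ^ n\<close> converge separately in the disc. Adding \<open>z\<close> times
  the second to the first, termwise or after a shift of index, gives the basis expansion or the
  Taylor series.\<close>

lemma expands_J:
  assumes l: "l \<in> vecs S"
  shows "expands a b l (J (bidiag \<beta> l))"
  unfolding expands_def
proof
  fix z :: complex assume "z \<in> ball 0 1"
  then have z: "norm z < 1" by simp
  let ?A = "taylor_fun (\<lambda>n. a n * l n) z" and ?B = "taylor_fun (\<lambda>n. b n * l n) z"
  have A: "(\<lambda>n. a n * l n * z ^ n) sums ?A" by (rule taylor_fun_sums[OF conv_radius_a[OF l] z])
  have B: "(\<lambda>n. z * (b n * l n * z ^ n)) sums (z * ?B)"
    by (rule sums_mult[OF taylor_fun_sums[OF conv_radius_b[OF l] z]])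
  have 1: "(\<lambda>n. l n * basis_fun a b n z) sums (?A + z * ?B)"
    using sums_add[OF A B] by (rule sums_cong[THEN iffD1, rotated]) (simp add: basis_fun_def algebra_simps)
  \<comment> \<open>The shift of index: the factor \<open>z\<close> raises each power by one, and
    the new term at index 0 contributes the summand 0.\<close>
  have "(\<lambda>n. case_nat 0 (\<lambda>m. b m * l m) n * z ^ n) sums (z * ?B + 0)"
    using sums_Suc[of "\<lambda>n. case_nat 0 (\<lambda>m. b m * l m) n * z ^ n" "z * ?B"] B by (simp add: ac_simps)
  from sums_add[OF A this] have "(\<lambda>n. a n * bidiag \<beta> l n * z ^ n) sums (?A + z * ?B)"
    by (simp add: a_bidiag distrib_right)
  moreover have "(\<lambda>n. a n * bidiag \<beta> l n * z ^ n) sums J (bidiag \<beta> l) z"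
    unfolding J_def using bidiag_mem l by (intro taylor_fun_sums[OF conv_radius_a z]) auto
  ultimately show "(\<lambda>n. l n * basis_fun a b n z) sums J (bidiag \<beta> l) z" using 1 sums_unique2 by metis
qed

lemma expands_unique:
  assumes l: "l \<in> vecs S" and e: "expands a b l f" and "\<And>z. z \<notin> ball 0 1 \<Longrightarrow> f z = 0"
  shows "f = J (bidiag \<beta> l)"
proof
  fix z show "f z = J (bidiag \<beta> l) z"
    using assms(3)[of z] J_zero_outside[of z] e expands_J[OF l] unfolding expands_def
    by (cases "z \<in> ball 0 1") (metis sums_unique2)+
qed

text \<open>Invertibility of \<open>bidiag \<beta>\<close> on \<open>S\<close>, hence the limsup
  condition, makes every \<open>u\<close> in \<open>S\<close> admissible: it comes from an expansion
  with coefficients in \<open>S\<close>.\<close>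

lemma vecs_disc_space: "vecs (disc_space S a b) = J ` vecs S"
proof
  show "vecs (disc_space S a b) \<subseteq> J ` vecs S"
    using expands_unique bidiag_mem by (auto simp: disc_space_def)
  show "J ` vecs S \<subseteq> vecs (disc_space S a b)"
  proof
    fix f assume "f \<in> J ` vecs S"
    then obtain u where u: "u \<in> vecs S" "f = J u" by auto
    obtain l where l: "l \<in> vecs S" "bidiag \<beta> l = u" using bidiag_inverse u by blast
    show "f \<in> vecs (disc_space S a b)"
      using taylor_fun_holomorphic[OF conv_radius_a[OF u(1)]] expands_J[OF l(1)] l u J_zero_outside
      by (auto simp: disc_space_def J_def)
  qed
qed

text \<open>The definite description in the norm is justified here: Taylor coefficients recover
  \<open>bidiag \<beta> l\<close>, and \<open>bidiag \<beta>\<close> is injective.\<close>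

lemma nrm_disc_space:
  assumes l: "l \<in> vecs S"
  shows "nrm (disc_space S a b) (J (bidiag \<beta> l)) = nrm S l"
proof -
  have "(THE m. m \<in> vecs S \<and> expands a b m (J (bidiag \<beta> l))) = l"
  proof (rule the_equality)
    fix m assume m: "m \<in> vecs S \<and> expands a b m (J (bidiag \<beta> l))"
    then have "J (bidiag \<beta> l) = J (bidiag \<beta> m)" using expands_unique J_zero_outside by blast
    then have "bidiag \<beta> l = bidiag \<beta> m" using U_J bidiag_mem l m by metis
    then show "m = l" using inj_bidiag by (metis injD)
  qed (use l expands_J in auto)
  then show ?thesis by (simp add: disc_space_def)
qed

text \<open>As functions on the disc are measured by their expansion coefficients, \<open>J\<close>
  is bounded because the inverse of \<open>bidiag \<beta>\<close> is, and \<open>U\<close> is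
  bounded because \<open>bidiag \<beta>\<close> is.\<close>

sublocale space_iso "disc_space S a b" S J U
proof
  fix u v c assume u: "u \<in> vecs S"
  have conv: "(\<lambda>n. a n * u n * z ^ n) sums J u z" if "u \<in> vecs S" "norm z < 1" for u z
    unfolding J_def by (rule taylor_fun_sums[OF conv_radius_a[OF that(1)] that(2)])
  show "J (fscale c u) = fscale c (J u)"
  proof
    fix z show "J (fscale c u) z = fscale c (J u) z"
    proof (cases "norm z < 1")
      case True
      show ?thesis
        using sums_unique2[OF conv[OF scale_mem[OF u, of c] True]] sums_mult[OF conv[OF u True], of c]
        by (simp add: fscale_def ac_simps)
    qed (simp add: J_zero_outside fscale_def)
  qed
  show "J (u + v) = J u + J v" if v: "v \<in> vecs S"
  proof
    fix z show "J (u + v) z = (J u + J v) z"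
    proof (cases "norm z < 1")
      case True
      show ?thesis
        using sums_unique2[OF conv[OF add_mem[OF u v] True]] sums_add[OF conv[OF u True] conv[OF v True]]
        by (simp add: algebra_simps)
    qed (simp add: J_zero_outside)
  qed
  show "J u \<in> vecs (disc_space S a b)" using u vecs_disc_space by blast
next
  fix x assume "x \<in> vecs (disc_space S a b)"
  then show "U x \<in> vecs S" "J (U x) = x" using vecs_disc_space U_J by auto
next
  obtain K where K: "\<forall>u\<in>vecs S. \<exists>l\<in>vecs S. bidiag \<beta> l = u \<and> nrm S l \<le> K * nrm S u"
    using bidiag_inverse by blast
  then show "\<exists>C. \<forall>u\<in>vecs S. nrm (disc_space S a b) (J u) \<le> C * nrm S u"
    using nrm_disc_space by metis
  obtain C where C: "\<forall>l\<in>vecs S. bidiag \<beta> l \<in> vecs S \<and> nrm S (bidiag \<beta> l) \<le> C * nrm S l"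
    using bidiag_mem by blast
  show "\<exists>C. \<forall>x\<in>vecs (disc_space S a b). nrm S (U x) \<le> C * nrm (disc_space S a b) x"
  proof (intro exI ballI)
    fix x assume "x \<in> vecs (disc_space S a b)"
    then obtain u where u: "u \<in> vecs S" "x = J u" using vecs_disc_space by auto
    obtain l where l: "l \<in> vecs S" "bidiag \<beta> l = u" using K u by blast
    show "nrm S (U x) \<le> C * nrm (disc_space S a b) x"
      using C l u U_J nrm_disc_space[OF l(1)] by auto
  qed
qed (use zero_mem add_mem scale_mem nrm_nonneg U_J in auto)

lemma disc_shift_J:
  assumes "u \<in> vecs S"
  shows "disc_shift w (J u) = J (seq_shift (\<lambda>n. w n * (a n / a (n - 1))) u)"
proof -
  have "taylor_coeff (J u) = (\<lambda>n. a n * u n)"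
    unfolding J_def by (rule taylor_coeff_taylor_fun[OF conv_radius_a[OF assms]])
  then show ?thesis
    unfolding disc_shift_eq J_def seq_shift_def using a_nz by (simp add: ac_simps)
qed

lemma similar_to_compact_pert_shift:
  assumes "bdd_above (range (\<lambda>n. norm (w (Suc n) * (a (Suc n) / a n))))"
  shows "similar_to_compact_pert S a b w"
proof -
  obtain M where "\<And>n. norm (w (Suc n) * (a (Suc n) / a n)) \<le> M" using assms by (auto simp: bdd_above_def)
  then have "bounded_op S S (seq_shift (\<lambda>n. w n * (a n / a (n - 1))))"
    by (intro bounded_op_seq_shift[of _ M]) simp
  from similar_conjugate[OF this disc_shift_J]
  have "similar (disc_space S a b) (disc_shift w) S
      (\<lambda>x. seq_shift (\<lambda>n. w n * (a n / a (n - 1))) x + 0)" by simp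
  then show ?thesis using compact_op_zero unfolding similar_to_compact_pert_def by blast
qed

end

section \<open>Geometric decay\<close>

text \<open>Uniformity in \<open>k\<close> is the point: one rate serves every window, however late
  it starts. \<open>G\<close> leaves room for finitely many exceptional indices, and the predicate
  for \<open>1 / h\<close> expresses uniform growth of \<open>h\<close>.\<close>

definition geom_decay :: "(nat \<Rightarrow> real) \<Rightarrow> bool" where
  "geom_decay h \<longleftrightarrow> (\<exists>G \<theta>. 0 < \<theta> \<and> \<theta> < 1 \<and> (\<forall>k i. h (k + i) \<le> G * \<theta> ^ i * h k))"

text \<open>Finitely many positive values are comparable, with \<open>D\<close> as the sum of all
  their ratios, and at most \<open>M\<close> powers of \<open>\<theta>\<close> are lost in the
  initial stretch.\<close>

lemma geom_decay_eventually:
  assumes h: "\<And>n. 0 < h n" and \<theta>: "0 < \<theta>" "\<theta> < 1"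
    and le: "\<And>k i. M \<le> k \<Longrightarrow> h (k + i) \<le> G * \<theta> ^ i * h k"
  shows "geom_decay h"
proof -
  define D where "D = (\<Sum>j\<le>M. \<Sum>k\<le>M. h j / h k)"
  have D: "h j \<le> D * h k" if "j \<le> M" "k \<le> M" for j k
  proof -
    have "h j / h k \<le> (\<Sum>k\<le>M. h j / h k)"
      using that h by (intro member_le_sum) (auto intro: less_imp_le)
    also have "\<dots> \<le> D" unfolding D_def
      using that h by (intro member_le_sum) (auto intro!: sum_nonneg divide_nonneg_nonneg intro: less_imp_le)
    finally show ?thesis using h[of k] by (simp add: field_simps)
  qed
  have D0: "0 \<le> D" unfolding D_def using h by (intro sum_nonneg divide_nonneg_nonneg) (auto intro: less_imp_le)
  have "0 < G * h M" using less_le_trans[OF h[of "M + 0"] le[of M 0]] by simp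
  then have G: "0 \<le> G" using h[of M] by (simp add: zero_less_mult_iff)
  \<comment> \<open>One summand for each case: window beyond \<open>M\<close>, window before
    \<open>M\<close>, window across \<open>M\<close>.\<close>
  define G' where "G' = G + D / \<theta> ^ M + G * D / \<theta> ^ M"
  have G': "G \<le> G'" "D / \<theta> ^ M \<le> G'" "G * D / \<theta> ^ M \<le> G'" using G D0 \<theta> by (auto simp: G'_def)
  have "h (k + i) \<le> G' * \<theta> ^ i * h k" for k i
  proof -
    consider "M \<le> k" | "k < M" "k + i \<le> M" | "k < M" "M < k + i" by linarith
    then show ?thesis
    proof cases
      case 1
      have "G * \<theta> ^ i * h k \<le> G' * \<theta> ^ i * h k"
        using G' \<theta> h[of k] by (intro mult_right_mono) (auto intro: less_imp_le)
      then show ?thesis using le[OF 1, of i] by linarith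
    next
      case 2
      have "\<theta> ^ M \<le> \<theta> ^ i" using 2 \<theta> by (intro power_decreasing) auto
      then have "D * 1 \<le> D * (\<theta> ^ i / \<theta> ^ M)" using D0 \<theta> by (intro mult_left_mono) auto
      then have "D \<le> D / \<theta> ^ M * \<theta> ^ i" by simp
      also have "\<dots> \<le> G' * \<theta> ^ i" using G' \<theta> by (intro mult_right_mono) auto
      finally have "D * h k \<le> G' * \<theta> ^ i * h k" using h[of k] by (intro mult_right_mono) (auto intro: less_imp_le)
      then show ?thesis using D[of "k + i" k] 2 by simp
    next
      case 3
      have "\<theta> ^ (k + i - M) * \<theta> ^ M \<le> \<theta> ^ i"
        using 3 \<theta> by (simp flip: power_add)
      then have t: "\<theta> ^ (k + i - M) \<le> \<theta> ^ i / \<theta> ^ M" using \<theta> by (simp add: field_simps)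
      have "h (k + i) \<le> G * \<theta> ^ (k + i - M) * h M" using le[of M "k + i - M"] 3 by simp
      also have "\<dots> \<le> G * (\<theta> ^ i / \<theta> ^ M) * (D * h k)"
        using D[of M k] 3 t G \<theta> h[of M] by (intro mult_mono) (auto intro: less_imp_le)
      also have "\<dots> = G * D / \<theta> ^ M * \<theta> ^ i * h k" by simp
      also have "\<dots> \<le> G' * \<theta> ^ i * h k"
        using G' \<theta> h[of k] by (intro mult_right_mono) (auto intro: less_imp_le)
      finally show ?thesis .
    qed
  qed
  then show ?thesis using \<theta> unfolding geom_decay_def by blast
qed

text \<open>Full windows of length \<open>n\<close> contract by \<open>\<tau>\<close>, hence the
  rate \<open>root n \<tau>\<close>. Fewer than \<open>n\<close> steps remain, and for these
  \<open>G = (A' / \<theta>) ^ n\<close> pays.\<close>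

lemma geom_decay_of_contraction:
  assumes h: "\<And>n. 0 < h n" and \<tau>: "0 < \<tau>" "\<tau> < 1" and n: "1 \<le> n"
    and step: "\<And>k. N \<le> k \<Longrightarrow> h (Suc k) \<le> A * h k"
    and contr: "\<And>k. N \<le> k \<Longrightarrow> h (k + n) \<le> \<tau> * h k"
  shows "geom_decay h"
proof -
  define \<theta> where "\<theta> = root n \<tau>"
  have \<theta>: "0 < \<theta>" "\<theta> < 1" "\<theta> ^ n = \<tau>" using \<tau> n by (auto simp: \<theta>_def)
  define A' where "A' = max A 1"
  have A': "1 \<le> A'" "A \<le> A'" by (auto simp: A'_def)
  have stepi: "h (k + i) \<le> A' ^ i * h k" if "N \<le> k" for k i
  proof (induction i)
    case (Suc i)
    have "h (k + Suc i) \<le> A' * h (k + i)"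
      using order_trans[OF step[of "k + i"] mult_right_mono[OF A'(2)]] that h[of "k + i"] by simp
    also have "\<dots> \<le> A' * (A' ^ i * h k)" using Suc A' by (intro mult_left_mono) auto
    finally show ?case by simp
  qed simp
  define G where "G = (A' / \<theta>) ^ n"
  have "h (k + i) \<le> G * \<theta> ^ i * h k" if k: "N \<le> k" for k i
  proof (induction i rule: less_induct)
    case (less i)
    show ?case
    proof (cases "i < n")
      case True
      have "1 \<le> A' / \<theta>" using A' \<theta> by (simp add: field_simps)
      then have "(A' / \<theta>) ^ i \<le> G" unfolding G_def using True by (intro power_increasing) auto
      then have "A' ^ i \<le> G * \<theta> ^ i" using \<theta> by (simp add: power_divide field_simps)
      then have "A' ^ i * h k \<le> G * \<theta> ^ i * h k" using h[of k] by (intro mult_right_mono) (auto intro: less_imp_le)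
      then show ?thesis using stepi[OF k, of i] by linarith
    next
      case False
      have "h (k + i) \<le> \<tau> * h (k + (i - n))" using contr[of "k + (i - n)"] k False by simp
      also have "\<dots> \<le> \<tau> * (G * \<theta> ^ (i - n) * h k)" using less.IH[of "i - n"] False n \<tau> by (intro mult_left_mono) auto
      also have "\<dots> = G * (\<theta> ^ n * \<theta> ^ (i - n)) * h k" by (simp add: \<theta>(3))
      also have "\<theta> ^ n * \<theta> ^ (i - n) = \<theta> ^ i" using False by (simp flip: power_add)
      finally show ?thesis .
    qed
  qed
  then show ?thesis by (rule geom_decay_eventually[OF h \<theta>(1,2)])
qed

text \<open>Roots turn a geometric rate into a geometric rate. The dichotomy is applied to
  \<open>norm (\<phi> n) powr q\<close>, and this returns to \<open>norm (\<phi> n)\<close>.\<close>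

lemma geom_decay_powr:
  assumes h: "\<And>n. 0 < h n" and q: "0 < q" and d: "geom_decay (\<lambda>n. h n powr q)"
  shows "geom_decay h"
proof -
  obtain G \<theta> where \<theta>: "0 < \<theta>" "\<theta> < 1" and le: "\<And>k i. h (k + i) powr q \<le> G * \<theta> ^ i * h k powr q"
    using d unfolding geom_decay_def by blast
  have "0 < G * h 0 powr q" using less_le_trans[OF _ le[of 0 0]] h[of 0] by simp
  then have G: "0 < G" by (simp add: zero_less_mult_iff)
  have "h (k + i) \<le> G powr (1 / q) * (\<theta> powr (1 / q)) ^ i * h k" for k i
  proof -
    have "(h (k + i) powr q) powr (1 / q) \<le> (G * \<theta> ^ i * h k powr q) powr (1 / q)"
      using le[of k i] q by (intro powr_mono2) auto
    also have "(h (k + i) powr q) powr (1 / q) = h (k + i)" using h[of "k + i"] q by (simp add: powr_powr)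
    also have "(G * \<theta> ^ i * h k powr q) powr (1 / q) = G powr (1 / q) * (\<theta> ^ i) powr (1 / q) * h k"
      using G \<theta> h[of k] q by (simp add: powr_mult powr_powr)
    also have "(\<theta> ^ i) powr (1 / q) = (\<theta> powr (1 / q)) ^ i"
      using \<theta> by (simp add: powr_powr powr_mult mult.commute flip: powr_realpow)
    finally show ?thesis .
  qed
  moreover have "\<theta> powr (1 / q) < 1" using \<theta> q powr_less_mono2[of "1 / q" \<theta> 1] by simp
  ultimately show ?thesis using \<theta> unfolding geom_decay_def by (intro exI conjI) auto
qed

text \<open>Once the partial sums from some \<open>k\<close> on exceed \<open>2 * C * h k\<close>, the right end point has to pay
  for each further partial sum, which forces exponential growth. If this never happens, the tail
  sums are comparable to their first term, which forces exponential decay.\<close>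

lemma geom_decay_dichotomy:
  fixes h :: "nat \<Rightarrow> real"
  assumes h: "\<And>n. 0 < h n"
    and le: "\<And>I J. N \<le> I \<Longrightarrow> I \<le> J \<Longrightarrow> sum h {I..J} \<le> C * (h I + h (Suc J))"
  shows "geom_decay h \<or> geom_decay (\<lambda>n. 1 / h n)"
proof -
  have "0 < C * (h N + h (Suc N))" using less_le_trans[OF _ le[of N N]] h[of N] by simp
  then have C: "0 < C" using add_pos_pos[OF h[of N] h[of "Suc N"]] by (simp add: zero_less_mult_iff)
  show ?thesis
  proof (cases "\<forall>k\<ge>N. \<forall>J\<ge>k. sum h {k..J} \<le> 2 * C * h k")
    case True
    have part: "(\<Sum>i<n. h (k + i)) \<le> 2 * C * h k" if k: "N \<le> k" for k n
    proof (cases n)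
      case 0 then show ?thesis using C h[of k] by simp
    next
      case (Suc m)
      have "(\<Sum>i<n. h (k + i)) = sum h {k..k + m}"
        using sum.shift_bounds_cl_nat_ivl[of h 0 k m] Suc
        by (simp add: lessThan_Suc_atMost atMost_atLeast0 add.commute)
      then show ?thesis using True k by simp
    qed
    have sm: "summable (\<lambda>i. h (k + i))" if "N \<le> k" for k
      using part[OF that] h by (intro summableI_nonneg_bounded) (auto intro: less_imp_le)
    define t where "t k = (\<Sum>i. h (k + i))" for k
    have t_le: "t k \<le> 2 * C * h k" if "N \<le> k" for k
      unfolding t_def by (rule suminf_le_const[OF sm[OF that] part[OF that]])
    have t_split: "t k = h k + t (Suc k)" if "N \<le> k" for k
      unfolding t_def using suminf_split_head[OF sm[OF that]] by simp
    have t_pos: "0 < t k" if "N \<le> k" for k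
      unfolding t_def using sm[OF that] h by (intro suminf_pos) auto
    \<comment> \<open>From \<open>t k \<le> 2 * C * h k\<close> at least the fraction
      \<open>1 / (2 * C)\<close> of the tail sits in its first term; removing that term leaves the
      factor \<open>\<theta>\<close>.\<close>
    define \<theta> where "\<theta> = 1 - 1 / (2 * C)"
    have \<theta>: "0 < \<theta>" "\<theta> < 1"
    proof -
      have "h N < 2 * C * h N" using t_split[of N] t_pos[of "Suc N"] t_le[of N] by simp
      then have "1 < 2 * C" using h[of N] by simp
      then show "0 < \<theta>" "\<theta> < 1" using C by (auto simp: \<theta>_def field_simps)
    qed
    have t_step: "t (Suc k) \<le> \<theta> * t k" if "N \<le> k" for k
    proof -
      have "t k / (2 * C) \<le> h k" using t_le[OF that] C by (simp add: field_simps)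
      then show ?thesis using t_split[OF that] by (simp add: \<theta>_def left_diff_distrib)
    qed
    have "h (k + i) \<le> (2 * C) * \<theta> ^ i * h k" if k: "N \<le> k" for k i
    proof -
      have "t (k + i) \<le> \<theta> ^ i * t k"
      proof (induction i)
        case (Suc i)
        then show ?case
          using order_trans[OF t_step[of "k + i"] mult_left_mono[OF Suc]] k \<theta> by (simp add: mult.assoc)
      qed simp
      also have "\<dots> \<le> \<theta> ^ i * (2 * C * h k)" using t_le[OF k] \<theta> by (intro mult_left_mono) auto
      finally show ?thesis
        using t_split[of "k + i"] t_pos[of "Suc (k + i)"] k by (simp add: ac_simps)
    qed
    then have "geom_decay h" by (rule geom_decay_eventually[OF h \<theta>])
    then show ?thesis by blast
  next
    case False
    then obtain k J0 where k: "N \<le> k" "k \<le> J0" "2 * C * h k < sum h {k..J0}" by (auto simp: not_le)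
    define s where "s J = sum h {k..J}" for J
    have s_Suc: "s (Suc J) = s J + h (Suc J)" if "k \<le> J" for J using that by (simp add: s_def)
    have s_mono: "s J0 \<le> s J" if "J0 \<le> J" for J
      unfolding s_def using that h by (intro sum_mono2) (auto intro: less_imp_le)
    \<comment> \<open>The left end point accounts for less than half of \<open>s J\<close>, so it is
      absorbed and the right end point carries the rest.\<close>
    have pay: "s J \<le> 2 * C * h (Suc J)" if J: "J0 \<le> J" for J
    proof -
      have "s J \<le> C * h k + C * h (Suc J)" using le[of k J] k J by (simp add: s_def distrib_left)
      moreover have "2 * (C * h k) < s J" using s_mono[OF J] k(3) by (simp add: s_def)
      ultimately show ?thesis by simp
    qed
    \<comment> \<open>By \<open>pay\<close>, adding \<open>h (Suc J)\<close> enlarges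
      \<open>s J\<close> at least by the factor \<open>1 + 1 / (2 * C)\<close>.\<close>
    define \<theta> where "\<theta> = 1 / (1 + 1 / (2 * C))"
    have \<theta>: "0 < \<theta>" "\<theta> < 1" using C by (auto simp: \<theta>_def field_simps)
    have s_step: "s J \<le> \<theta> * s (Suc J)" if J: "J0 \<le> J" for J
    proof -
      have "s J * (1 + 1 / (2 * C)) \<le> s (Suc J)"
        using pay[OF J] s_Suc[of J] k J C by (simp add: field_simps)
      then show ?thesis unfolding \<theta>_def using C by (simp add: field_simps)
    qed
    have s_geom: "s j \<le> \<theta> ^ i * s (j + i)" if j: "J0 \<le> j" for i j
    proof (induction i)
      case (Suc i)
      have "\<theta> ^ i * s (j + i) \<le> \<theta> ^ i * (\<theta> * s (Suc (j + i)))"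
        using s_step[of "j + i"] j \<theta> by (intro mult_left_mono) auto
      then show ?case using Suc by (simp add: ac_simps)
    qed simp
    have h_le_s: "h j \<le> s j" if "k \<le> j" for j
      unfolding s_def using that h by (intro member_le_sum) (auto intro: less_imp_le)
    \<comment> \<open>\<open>pay\<close> bounds \<open>s\<close> by \<open>h\<close> one index
      later, so one power of \<open>\<theta>\<close> is missing, whence
      \<open>2 * C / \<theta>\<close>; the summand 1 covers \<open>i = 0\<close>.\<close>
    define G where "G = 2 * C / \<theta> + 1"
    have G: "1 \<le> G" "2 * C / \<theta> \<le> G" using C \<theta> by (auto simp: G_def)
    have "1 / h (j + i) \<le> G * \<theta> ^ i * (1 / h j)" if j: "J0 \<le> j" for j i
    proof -
      have "h j \<le> G * \<theta> ^ i * h (j + i)"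
      proof (cases i)
        case 0 then show ?thesis using G h[of j] by simp
      next
        case (Suc m)
        have "h j \<le> \<theta> ^ m * s (j + m)" using h_le_s[of j] s_geom[OF j, of m] k j by simp
        also have "\<dots> \<le> \<theta> ^ m * (2 * C * h (Suc (j + m)))"
          using pay[of "j + m"] j \<theta> by (intro mult_left_mono) auto
        also have "\<dots> = 2 * C / \<theta> * \<theta> ^ i * h (j + i)" using \<theta> Suc by simp
        also have "\<dots> \<le> G * \<theta> ^ i * h (j + i)"
          using G \<theta> h[of "j + i"] by (intro mult_right_mono) (auto intro: less_imp_le)
        finally show ?thesis .
      qed
      then show ?thesis using h[of j] h[of "j + i"] by (simp add: field_simps)
    qed
    moreover have "0 < 1 / h n" for n using h by simp
    ultimately have "geom_decay (\<lambda>n. 1 / h n)" using \<theta> by (intro geom_decay_eventually)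
    then show ?thesis by blast
  qed
qed

section \<open>Weighted backward shifts\<close>

text \<open>For \<mu> \<noteq> 0, the sequence \<open>1 / weight_ratio \<alpha> \<mu> n\<close> is
  the formal eigenvector of the backward shift for \<mu> with first entry 1, and
  \<open>weight_ratio \<alpha> \<mu>\<close> is the integrating factor that makes the recursion
  telescope.\<close>

definition weight_ratio :: "(nat \<Rightarrow> complex) \<Rightarrow> complex \<Rightarrow> nat \<Rightarrow> complex" where
  "weight_ratio \<alpha> \<mu> n = (\<Prod>i=1..n. \<alpha> i) / \<mu> ^ n"

locale weighted_shift =
  fixes \<alpha> :: "nat \<Rightarrow> complex" and \<mu> :: complex
  assumes \<alpha>_nz: "\<alpha> n \<noteq> 0"
begin

definition L :: "(nat \<Rightarrow> complex) \<Rightarrow> (nat \<Rightarrow> complex)" where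
  "L x = seq_shift \<alpha> x - fscale \<mu> x"

lemma L_apply: "L x n = \<alpha> (Suc n) * x (Suc n) - \<mu> * x n"
  by (simp add: L_def seq_shift_def fscale_def)

abbreviation \<phi> :: "nat \<Rightarrow> complex" where
  "\<phi> \<equiv> weight_ratio \<alpha> \<mu>"

lemma \<phi>_nz: "\<mu> \<noteq> 0 \<Longrightarrow> \<phi> n \<noteq> 0"
  using \<alpha>_nz by (simp add: weight_ratio_def)

lemma \<phi>_Suc: "\<mu> \<noteq> 0 \<Longrightarrow> \<phi> n * \<alpha> (Suc n) = \<mu> * \<phi> (Suc n)"
  by (simp add: weight_ratio_def)

text \<open>All weights being non-zero, entry 0 determines a formal solution of the homogeneous
  recursion.\<close>

lemma ker_L:
  assumes u: "L u = 0" and v: "L v = 0" and nz: "u \<noteq> 0"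
  shows "\<exists>c. v = fscale c u"
proof -
  have rec: "x (Suc n) = \<mu> * x n / \<alpha> (Suc n)" if "L x = 0" for x n
    using fun_cong[OF that, of n] \<alpha>_nz by (simp add: L_apply field_simps)
  have "u 0 \<noteq> 0"
  proof
    assume 0: "u 0 = 0"
    have "u n = 0" for n by (induction n) (simp_all add: 0 rec[OF u])
    then show False using nz by auto
  qed
  have "v n = v 0 / u 0 * u n" for n
  proof (induction n)
    case (Suc n)
    show ?case unfolding rec[OF u, of n] rec[OF v, of n] Suc by simp
  qed (use \<open>u 0 \<noteq> 0\<close> in simp)
  then have "v = fscale (v 0 / u 0) u" unfolding fscale_def by (rule ext)
  then show ?thesis by blast
qed

text \<open>When \<open>\<phi>\<close> decays, the telescoped recursion is summed from infinity:
  \<open>x n\<close> is minus the tail of the series of \<open>\<phi> j * y j\<close>, divided by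
  \<open>\<mu> * \<phi> n\<close>. Uniform decay bounds it by the reverse geometric convolution
  \<open>z\<close> of \<open>y\<close>.\<close>

lemma surj_L_of_decay:
  assumes p: "1 \<le> p" and \<mu>: "\<mu> \<noteq> 0" and decay: "geom_decay (\<lambda>n. norm (\<phi> n))" and y: "y \<in> vecs (lp p)"
  shows "\<exists>x\<in>vecs (lp p). L x = y"
proof -
  obtain G \<theta> where \<theta>: "0 < \<theta>" "\<theta> < 1" and le: "\<And>k i. norm (\<phi> (k + i)) \<le> G * \<theta> ^ i * norm (\<phi> k)"
    using decay unfolding geom_decay_def by blast
  have "0 < G * norm (\<phi> 0)" using less_le_trans[OF _ le[of 0 0]] \<phi>_nz[OF \<mu>] by simp
  then have G: "0 \<le> G" by (simp add: zero_less_mult_iff)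
  let ?Y = "nrm (lp p) y"
  have Yn: "norm (y n) \<le> ?Y" for n by (rule lp_norm_le_nrm[OF p y])
  define z where "z n = (\<Sum>i. \<theta> ^ i * norm (y (n + i)))" for n
  have sz: "summable (\<lambda>i. \<theta> ^ i * norm (y (n + i)))" for n
  proof (rule summable_comparison_test'[where N = 0])
    show "summable (\<lambda>i. ?Y * \<theta> ^ i)" using \<theta> by (intro summable_mult summable_geometric) auto
    fix i show "norm (\<theta> ^ i * norm (y (n + i))) \<le> ?Y * \<theta> ^ i"
      using mult_right_mono[OF Yn[of "n + i"], of "\<theta> ^ i"] \<theta> by (simp add: mult.commute)
  qed
  have z0: "0 \<le> z n" for n unfolding z_def using \<theta> by (intro suminf_nonneg[OF sz]) auto
  have zS: "z n = \<theta> * z (Suc n) + norm (y n)" for n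
  proof -
    have "(\<Sum>i. \<theta> ^ Suc i * norm (y (n + Suc i))) = \<theta> * z (Suc n)"
      unfolding z_def using suminf_mult[OF sz[of "Suc n"], of \<theta>] by (simp add: mult.assoc)
    then show ?thesis using suminf_split_head[OF sz[of n]] by (simp add: z_def)
  qed
  have zY: "z n \<le> ?Y * (1 / (1 - \<theta>))" for n
  proof -
    have "z n \<le> (\<Sum>i. ?Y * \<theta> ^ i)" unfolding z_def
    proof (rule suminf_le[OF _ sz])
      show "summable (\<lambda>i. ?Y * \<theta> ^ i)" using \<theta> by (intro summable_mult summable_geometric) auto
      fix i show "\<theta> ^ i * norm (y (n + i)) \<le> ?Y * \<theta> ^ i"
        using mult_right_mono[OF Yn[of "n + i"], of "\<theta> ^ i"] \<theta> by (simp add: mult.commute)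
    qed
    also have "\<dots> = ?Y * (1 / (1 - \<theta>))" using \<theta> by (simp add: suminf_mult suminf_geometric)
    finally show ?thesis .
  qed
  have nz: "norm (complex_of_real (z n)) = z n" for n using z0 by (simp only: norm_of_real abs_of_nonneg)
  have zm: "(\<lambda>n. complex_of_real (z n)) \<in> vecs (lp p)"
  proof (rule lp_reverse_geometric_conv[OF p y, of \<theta>])
    fix n
    show "norm (complex_of_real (z n)) \<le> ?Y * (1 / (1 - \<theta>))" unfolding nz by (rule zY)
    show "norm (complex_of_real (z n)) \<le> \<theta> * norm (complex_of_real (z (Suc n))) + norm (y n)"
      unfolding nz using zS[of n] by simp
  qed (use \<theta> in auto)
  have bnd: "norm (\<phi> (n + i) * y (n + i)) \<le> G * norm (\<phi> n) * (\<theta> ^ i * norm (y (n + i)))" for n i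
    using mult_right_mono[OF le[of n i], of "norm (y (n + i))"] by (simp add: norm_mult ac_simps)
  have ss: "summable (\<lambda>i. \<phi> (n + i) * y (n + i))" for n
    by (rule summable_comparison_test'[OF summable_mult[OF sz[of n], of "G * norm (\<phi> n)"], of 0]) (rule bnd)
  define s where "s n = (\<Sum>i. \<phi> (n + i) * y (n + i))" for n
  have s_split: "s n = \<phi> n * y n + s (Suc n)" for n
    unfolding s_def using suminf_split_head[OF ss[of n]] by simp
  have s_le: "norm (s n) \<le> G * norm (\<phi> n) * z n" for n
  proof -
    have "norm (s n) \<le> (\<Sum>i. G * norm (\<phi> n) * (\<theta> ^ i * norm (y (n + i))))"
      unfolding s_def by (rule norm_suminf_le[OF bnd summable_mult[OF sz]])
    then show ?thesis by (simp add: z_def suminf_mult[OF sz])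
  qed
  define x where "x n = - s n / (\<mu> * \<phi> n)" for n
  have "norm (x n) \<le> G / norm \<mu> * norm (complex_of_real (z n))" for n
    using s_le[of n] \<phi>_nz[OF \<mu>, of n] \<mu> z0[of n] by (simp add: x_def norm_divide norm_mult field_simps)
  then have xm: "x \<in> vecs (lp p)"
    using seq_space.solid_scaled[OF seq_space_lp[OF p] zm, of "G / norm \<mu>" x] G by simp
  have "L x = y"
  proof
    fix n
    have "\<alpha> (Suc n) * x (Suc n) = - s (Suc n) / \<phi> n"
      using \<phi>_Suc[OF \<mu>, of n] \<phi>_nz[OF \<mu>] \<mu> by (simp add: x_def frac_eq_eq mult.commute flip: \<phi>_Suc)
        (simp add: field_simps \<alpha>_nz)
    moreover have "\<mu> * x n = - s n / \<phi> n" using \<mu> by (simp add: x_def)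
    ultimately have "L x n = (s n - s (Suc n)) / \<phi> n" by (simp add: L_apply diff_divide_distrib)
    then show "L x n = y n" using s_split[of n] \<phi>_nz[OF \<mu>, of n] by simp
  qed
  then show ?thesis using xm by blast
qed

text \<open>When \<open>\<phi>\<close> grows, the telescoped recursion is summed from 0, with
  \<open>x 0 = 0\<close>. Uniform growth bounds the quotient by the forward geometric convolution
  \<open>z\<close> of \<open>y\<close>.\<close>

lemma surj_L_of_growth:
  assumes p: "1 \<le> p" and \<mu>: "\<mu> \<noteq> 0" and growth: "geom_decay (\<lambda>n. 1 / norm (\<phi> n))" and y: "y \<in> vecs (lp p)"
  shows "\<exists>x\<in>vecs (lp p). L x = y"
proof -
  obtain G \<theta> where \<theta>: "0 < \<theta>" "\<theta> < 1" and le: "\<And>k i. 1 / norm (\<phi> (k + i)) \<le> G * \<theta> ^ i * (1 / norm (\<phi> k))"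
    using growth unfolding geom_decay_def by blast
  have "0 < G * (1 / norm (\<phi> 0))" using less_le_trans[OF _ le[of 0 0]] \<phi>_nz[OF \<mu>] by simp
  then have G: "0 \<le> G" by (simp add: zero_less_divide_iff)
  have le': "norm (\<phi> k) \<le> G * \<theta> ^ i * norm (\<phi> (k + i))" for k i
    using le[of k i] \<phi>_nz[OF \<mu>, of k] \<phi>_nz[OF \<mu>, of "k + i"] by (simp add: field_simps)
  define z where "z n = (\<Sum>j\<le>n. \<theta> ^ (n - j) * norm (y j))" for n
  have z0: "0 \<le> z n" for n unfolding z_def using \<theta> by (intro sum_nonneg) auto
  have zS: "z (Suc n) = \<theta> * z n + norm (y (Suc n))" for n
    by (simp add: z_def sum_distrib_left Suc_diff_le mult.assoc)
  have nz: "norm (complex_of_real (z n)) = z n" for n using z0 by (simp only: norm_of_real abs_of_nonneg)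
  have zm: "(\<lambda>n. complex_of_real (z n)) \<in> vecs (lp p)"
    by (rule conjunct1[OF lp_geometric_conv[OF p y, of \<theta>]], unfold nz)
      (use \<theta> zS in \<open>auto simp: z_def[of 0]\<close>)
  define s where "s n = (\<Sum>j<n. \<phi> j * y j)" for n
  have s_le: "norm (s n) \<le> G * norm (\<phi> n) * z n" for n
  proof -
    have "norm (s n) \<le> (\<Sum>j<n. norm (\<phi> j * y j))" unfolding s_def by (rule norm_sum)
    also have "\<dots> \<le> (\<Sum>j<n. G * norm (\<phi> n) * (\<theta> ^ (n - j) * norm (y j)))"
    proof (rule sum_mono)
      fix j assume "j \<in> {..<n}"
      then show "norm (\<phi> j * y j) \<le> G * norm (\<phi> n) * (\<theta> ^ (n - j) * norm (y j))"
        using mult_right_mono[OF le'[of j "n - j"], of "norm (y j)"] by (simp add: norm_mult ac_simps)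
    qed
    also have "\<dots> \<le> (\<Sum>j\<le>n. G * norm (\<phi> n) * (\<theta> ^ (n - j) * norm (y j)))"
      using G \<theta> by (intro sum_mono2) auto
    finally show ?thesis by (simp add: z_def sum_distrib_left)
  qed
  define x where "x n = s n / (\<mu> * \<phi> n)" for n
  have "norm (x n) \<le> G / norm \<mu> * norm (complex_of_real (z n))" for n
    using s_le[of n] \<phi>_nz[OF \<mu>, of n] \<mu> z0[of n] by (simp add: x_def norm_divide norm_mult field_simps)
  then have xm: "x \<in> vecs (lp p)"
    using seq_space.solid_scaled[OF seq_space_lp[OF p] zm, of "G / norm \<mu>" x] G by simp
  have "L x = y"
  proof
    fix n
    have "\<alpha> (Suc n) * x (Suc n) = s (Suc n) / \<phi> n"
      using \<phi>_Suc[OF \<mu>, of n] \<phi>_nz[OF \<mu>] \<mu> by (simp add: x_def frac_eq_eq mult.commute flip: \<phi>_Suc)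
        (simp add: field_simps \<alpha>_nz)
    moreover have "\<mu> * x n = s n / \<phi> n" using \<mu> by (simp add: x_def)
    ultimately have "L x n = (s (Suc n) - s n) / \<phi> n" by (simp add: L_apply diff_divide_distrib)
    then show "L x n = y n" using \<phi>_nz[OF \<mu>, of n] by (simp add: s_def)
  qed
  then show ?thesis using xm by blast
qed

lemma surj_L_0:
  assumes p: "1 \<le> p" and \<mu>: "\<mu> = 0" and \<delta>: "0 < \<delta>" "\<And>n. \<delta> \<le> norm (\<alpha> (Suc n))" and y: "y \<in> vecs (lp p)"
  shows "\<exists>x\<in>vecs (lp p). L x = y"
proof
  interpret S: seq_space "lp p" by (rule seq_space_lp[OF p])
  let ?v = "\<lambda>n. y n / \<alpha> (Suc n)"
  have "norm (?v n) \<le> 1 / \<delta> * norm (y n)" for n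
    using \<delta>(1) mult_right_mono[OF \<delta>(2)[of n], of "norm (y n)"] \<alpha>_nz[of "Suc n"] by (simp add: norm_divide field_simps)
  then have "?v \<in> vecs (lp p)" using S.solid_scaled[OF y, of "1 / \<delta>" ?v] \<delta>(1) by simp
  then show "case_nat 0 ?v \<in> vecs (lp p)" using S.right_shift by blast
  show "L (case_nat 0 ?v) = y" 
    by (rule ext, unfold L_apply) (simp add: \<mu> \<alpha>_nz)
qed

text \<open>The last conjunct ranges over all formal solutions on the block, so the free initial value
  of the recursion cannot be used to keep a solution small.\<close>

definition bad_block :: "real \<Rightarrow> real \<Rightarrow> nat \<Rightarrow> nat \<Rightarrow> (nat \<Rightarrow> complex) \<Rightarrow> bool" where
  "bad_block p \<epsilon> I J y \<longleftrightarrow> I \<le> J \<and> (\<forall>n. n \<notin> {I..J} \<longrightarrow> y n = 0) \<and>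
     (\<forall>M. (\<Sum>n<M. norm (y n) powr p) \<le> \<epsilon>) \<and>
     (\<forall>u c. (\<forall>n\<in>{I..J}. L u n = c * y n) \<longrightarrow> norm c \<le> norm (u I) \<or> norm c \<le> norm (u (Suc J)))"

lemma bad_blockD:
  assumes "bad_block p \<epsilon> I J y"
  shows "I \<le> J" "\<And>n. n \<notin> {I..J} \<Longrightarrow> y n = 0" "\<And>M. (\<Sum>n<M. norm (y n) powr p) \<le> \<epsilon>"
    "\<And>u c. (\<And>n. n \<in> {I..J} \<Longrightarrow> L u n = c * y n) \<Longrightarrow> norm c \<le> norm (u I) \<or> norm c \<le> norm (u (Suc J))"
  using assms unfolding bad_block_def by blast+

text \<open>At \<mu> = 0 a single small weight is enough:
  \<open>\<alpha> (Suc n) * u (Suc n)\<close> must equal \<open>c\<close> times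
  \<open>\<epsilon> powr (1 / p)\<close>, which forces the right end point to be at least as large
  as \<open>c\<close>.\<close>

lemma bad_block_0:
  assumes p: "1 \<le> p" and \<mu>: "\<mu> = 0" and \<epsilon>: "0 < \<epsilon>" and \<alpha>: "norm (\<alpha> (Suc n)) \<le> \<epsilon> powr (1 / p)"
  shows "bad_block p \<epsilon> n n (\<lambda>k. if k = n then of_real (\<epsilon> powr (1 / p)) else 0)"
  unfolding bad_block_def
proof (intro conjI allI impI)
  fix M
  have "(\<Sum>k<M. norm (if k = n then complex_of_real (\<epsilon> powr (1 / p)) else 0) powr p)
      = (\<Sum>k<M. if k = n then \<epsilon> else 0)"
    using \<epsilon> p by (intro sum.cong) (auto simp: powr_powr)
  then show "(\<Sum>k<M. norm (if k = n then complex_of_real (\<epsilon> powr (1 / p)) else 0) powr p) \<le> \<epsilon>"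
    using \<epsilon> by simp
next
  fix u c
  assume "\<forall>k\<in>{n..n}. L u k = c * (if k = n then of_real (\<epsilon> powr (1 / p)) else 0)"
  then have "\<alpha> (Suc n) * u (Suc n) = c * of_real (\<epsilon> powr (1 / p))"
    unfolding L_apply by (simp add: \<mu>)
  then have "norm c * \<epsilon> powr (1 / p) = norm (\<alpha> (Suc n)) * norm (u (Suc n))"
    using \<epsilon> by (metis norm_mult norm_of_real abs_of_nonneg powr_ge_zero)
  also have "\<dots> \<le> \<epsilon> powr (1 / p) * norm (u (Suc n))" using \<alpha> by (intro mult_right_mono) auto
  finally show "norm c \<le> norm (u n) \<or> norm c \<le> norm (u (Suc n))" using \<epsilon> by simp
qed auto

text \<open>Multiplication by \<open>\<phi> n\<close> turns the recursion into \<mu> times a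
  difference of consecutive values of \<open>\<phi> n * u n\<close>, so the sum telescopes.\<close>

lemma sum_\<phi>_L:
  assumes \<mu>: "\<mu> \<noteq> 0" and "I \<le> J"
  shows "(\<Sum>n=I..J. \<phi> n * L u n) = \<mu> * (\<phi> (Suc J) * u (Suc J) - \<phi> I * u I)"
  using \<open>I \<le> J\<close>
proof (induction J rule: dec_induct)
  case base
  show ?case using \<phi>_Suc[OF \<mu>, of I] by (simp add: L_apply algebra_simps)
next
  case (step J)
  have eq: "\<phi> (Suc J) * L u (Suc J) = \<mu> * (\<phi> (Suc (Suc J)) * u (Suc (Suc J)) - \<phi> (Suc J) * u (Suc J))"
    using \<phi>_Suc[OF \<mu>, of "Suc J"] by (simp add: L_apply algebra_simps)
  have "(\<Sum>n=I..Suc J. \<phi> n * L u n) = (\<Sum>n=I..J. \<phi> n * L u n) + \<phi> (Suc J) * L u (Suc J)"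
    using step by simp
  also have "\<dots> = \<mu> * (\<phi> (Suc (Suc J)) * u (Suc (Suc J)) - \<phi> I * u I)"
    unfolding step.IH eq by (simp add: algebra_simps)
  finally show ?case .
qed

text \<open>The block is the equality case of Hoelder's inequality against \<open>\<phi>\<close>; the summation by parts
  \<open>sum_\<phi>_L\<close> leaves only the end points of the solution.\<close>

lemma bad_block_of_bump:
  assumes p: "1 < p" and q: "1 / p + 1 / q = 1" and \<mu>: "\<mu> \<noteq> 0" and \<epsilon>: "0 < \<epsilon>" and IJ: "I \<le> J"
    and bump: "(2 * norm \<mu>) powr q / \<epsilon> powr (q / p) * (norm (\<phi> I) powr q + norm (\<phi> (Suc J)) powr q)
      < (\<Sum>n=I..J. norm (\<phi> n) powr q)"
  shows "\<exists>y. bad_block p \<epsilon> I J y"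
proof -
  have "1 / q = (p - 1) / p" using p q by (simp add: diff_divide_distrib)
  then have q1: "q = p / (p - 1)" using p by (metis inverse_divide inverse_eq_divide inverse_inverse_eq)
  have q: "1 < q" "(q - 1) * p = q" using q1 p by (simp, simp add: field_simps)
  have "q / p = 1 / (p - 1)" using q1 p by simp
  then have q': "q - q / p = 1" using q1 p by (simp flip: diff_divide_distrib)
  define f where "f n = norm (\<phi> n)" for n
  have f0: "0 < f n" for n using \<phi>_nz[OF \<mu>] by (simp add: f_def)
  define Sb where "Sb = (\<Sum>n=I..J. f n powr q)"
  have Sb: "0 < Sb" unfolding Sb_def using IJ f0 by (intro sum_pos) (auto simp: less_imp_neq[THEN not_sym])
  \<comment> \<open>The scale that makes the p-th powers of the entries of \<open>y\<close> add up
    to exactly \<epsilon>.\<close>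
  define s where "s = (\<epsilon> / Sb) powr (1 / p)"
  have s0: "0 < s" using \<epsilon> Sb by (simp add: s_def)
  have sp: "s powr p = \<epsilon> / Sb" using \<epsilon> Sb p by (simp add: s_def powr_powr)
  \<comment> \<open>Modulus \<open>s * f n powr (q - 1)\<close> and the phase conjugate to
    \<open>\<phi> n\<close>; the exponent is \<open>q - 2\<close> because
    \<open>cnj (\<phi> n)\<close> supplies one factor \<open>f n\<close>.\<close>
  define y where "y n = (if n \<in> {I..J} then of_real (s * f n powr (q - 2)) * cnj (\<phi> n) else 0)" for n
  have y_norm: "norm (y n) powr p = s powr p * f n powr q" if "n \<in> {I..J}" for n
  proof -
    have "norm (y n) = s * (f n powr (q - 2) * f n powr 1)"
      using that s0 f0[of n] by (simp add: y_def norm_mult f_def)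
    also have "f n powr (q - 2) * f n powr 1 = f n powr (q - 1)" using powr_add[of "f n" "q - 2" 1] by simp
    finally show ?thesis using s0 q(2) by (simp add: powr_mult powr_powr)
  qed
  have \<phi>y: "\<phi> n * y n = of_real (s * f n powr q)" if "n \<in> {I..J}" for n
  proof -
    have "\<phi> n * cnj (\<phi> n) = of_real (f n powr 2)"
      using f0[of n] by (simp add: f_def complex_norm_square powr_realpow flip: of_real_power)
    then have "\<phi> n * y n = of_real (s * (f n powr (q - 2) * f n powr 2))"
      using that by (simp add: y_def ac_simps)
    then show ?thesis by (simp flip: powr_add)
  qed
  have "bad_block p \<epsilon> I J y"
    unfolding bad_block_def
  proof (intro conjI allI impI)
    fix M
    have "(\<Sum>n<M. norm (y n) powr p) \<le> (\<Sum>n\<in>{I..J}. norm (y n) powr p)"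
    proof -
      have "(\<Sum>n<M. norm (y n) powr p) = (\<Sum>n\<in>{..<M} \<inter> {I..J}. norm (y n) powr p)"
        using p by (intro sum.mono_neutral_right) (auto simp: y_def)
      also have "\<dots> \<le> (\<Sum>n\<in>{I..J}. norm (y n) powr p)" by (intro sum_mono2) auto
      finally show ?thesis .
    qed
    also have "\<dots> = s powr p * Sb" by (simp add: y_norm Sb_def sum_distrib_left)
    also have "\<dots> = \<epsilon>" using sp Sb by simp
    finally show "(\<Sum>n<M. norm (y n) powr p) \<le> \<epsilon>" .
  next
    fix u c assume u: "\<forall>n\<in>{I..J}. L u n = c * y n"
    show "norm c \<le> norm (u I) \<or> norm c \<le> norm (u (Suc J))"
    proof (rule ccontr)
      assume "\<not> ?thesis"
      then have small: "norm (u I) < norm c" "norm (u (Suc J)) < norm c" by auto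
      then have c: "0 < norm c" using norm_ge_zero le_less_trans by blast
      have "(\<Sum>n=I..J. \<phi> n * L u n) = (\<Sum>n=I..J. c * of_real (s * f n powr q))"
      proof (rule sum.cong[OF refl])
        fix n assume n: "n \<in> {I..J}"
        then have "\<phi> n * L u n = c * (\<phi> n * y n)" using u by simp
        then show "\<phi> n * L u n = c * of_real (s * f n powr q)" unfolding \<phi>y[OF n] .
      qed
      also have "\<dots> = c * of_real (s * Sb)" by (simp add: Sb_def sum_distrib_left)
      finally have "norm (c * of_real (s * Sb)) = norm (\<mu> * (\<phi> (Suc J) * u (Suc J) - \<phi> I * u I))"
        by (simp add: sum_\<phi>_L[OF \<mu> IJ])
      then have "norm c * (s * Sb) = norm \<mu> * norm (\<phi> (Suc J) * u (Suc J) - \<phi> I * u I)"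
        using s0 Sb by (simp add: norm_mult)
      also have "\<dots> \<le> norm \<mu> * (f (Suc J) * norm c + f I * norm c)"
      proof -
        have "norm (\<phi> (Suc J) * u (Suc J) - \<phi> I * u I) \<le> f (Suc J) * norm (u (Suc J)) + f I * norm (u I)"
          unfolding f_def by (metis norm_mult norm_triangle_ineq4)
        also have "\<dots> \<le> f (Suc J) * norm c + f I * norm c"
          using small f0 by (intro add_mono mult_left_mono) (auto intro: less_imp_le)
        finally show ?thesis by (intro mult_left_mono) auto
      qed
      also have "\<dots> = norm c * (norm \<mu> * (f I + f (Suc J)))" by (simp add: algebra_simps)
      finally have "s * Sb \<le> norm \<mu> * (f I + f (Suc J))" using c by simp
      also have "\<dots> \<le> 2 * norm \<mu> * max (f I) (f (Suc J))"
      proof -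
        have "f I + f (Suc J) \<le> 2 * max (f I) (f (Suc J))" by simp
        from mult_left_mono[OF this, of "norm \<mu>"] show ?thesis by simp
      qed
      finally have "(s * Sb) powr q \<le> (2 * norm \<mu> * max (f I) (f (Suc J))) powr q"
        using q s0 Sb by (intro powr_mono2) auto
      also have "\<dots> = (2 * norm \<mu>) powr q * max (f I) (f (Suc J)) powr q"
        using f0[of I] by (simp add: powr_mult)
      also have "\<dots> \<le> (2 * norm \<mu>) powr q * (f I powr q + f (Suc J) powr q)"
        by (intro mult_left_mono) (auto simp: max_def)
      also have "\<dots> < \<epsilon> powr (q / p) * Sb"
        using bump \<epsilon> unfolding f_def[symmetric] Sb_def[symmetric] by (simp add: field_simps)
      finally have "(s * Sb) powr q < \<epsilon> powr (q / p) * Sb" .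
      \<comment> \<open>Since \<open>q - q / p = 1\<close>, this equals
        \<open>\<epsilon> powr (q / p) * Sb\<close>; the constant in \<open>bump\<close> is chosen
        to contradict exactly this.\<close>
      moreover have "(s * Sb) powr q = \<epsilon> powr (q / p) * (Sb powr q / Sb powr (q / p))"
        using s0 Sb \<epsilon> p by (simp add: s_def powr_mult powr_powr powr_divide mult.commute)
      moreover have "Sb powr q / Sb powr (q / p) = Sb" using Sb q' by (simp flip: powr_diff)
      ultimately show False by simp
    qed
  qed (use IJ in \<open>auto simp: y_def\<close>)
  then show ?thesis by blast
qed

end

section \<open>Infinite codimension by a gliding hump\<close>

lemma sum_fun_apply: "(\<Sum>i\<in>A. f i) n = (\<Sum>i\<in>A. f i n)"
  by (induction A rule: infinite_finite_induct) auto

text \<open>One vector more than the spanning set has is dependent. The vectors form an indexed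
  family, and a repetition, invisible to dependence of sets, gives the relation with coefficients 1
  and -1.\<close>

lemma span_family_dependent:
  fixes s :: "nat \<Rightarrow> 'i \<Rightarrow> complex"
  assumes B: "finite B" and s: "\<And>i. i \<le> card B \<Longrightarrow> s i \<in> fvs.span B"
  obtains d :: "nat \<Rightarrow> complex" and i where "i \<le> card B" "d i \<noteq> 0" "\<And>n. (\<Sum>i\<le>card B. d i * s i n) = 0"
proof (cases "inj_on s {..card B}")
  case True
  let ?S = "s ` {..card B}"
  have "card ?S = Suc (card B)" using card_image[OF True] by simp
  then have "fvs.dependent ?S"
    using fvs.independent_span_bound[OF B, of ?S] s by fastforce
  then obtain u where u: "\<exists>v\<in>?S. u v \<noteq> 0" "(\<Sum>v\<in>?S. fscale (u v) v) = 0"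
    using fvs.dependent_finite[of ?S] by auto
  have "(\<Sum>i\<le>card B. fscale (u (s i)) (s i)) = 0" using u(2) by (simp add: sum.reindex[OF True])
  then have "(\<Sum>i\<le>card B. fscale (u (s i)) (s i)) n = 0" for n by simp
  then have "(\<Sum>i\<le>card B. u (s i) * s i n) = 0" for n by (simp add: fscale_def sum_fun_apply)
  then show ?thesis using u(1) that[of _ "\<lambda>i. u (s i)"] by auto
next
  case False
  then obtain i j where ij: "i \<le> card B" "j \<le> card B" "i \<noteq> j" "s i = s j" by (auto simp: inj_on_def)
  let ?d = "\<lambda>k. if k = i then 1 else if k = j then - 1 else 0 :: complex"
  have "(\<Sum>k\<le>card B. ?d k * s k n) = (\<Sum>k\<in>{i, j}. ?d k * s k n)" for n
    by (rule sum.mono_neutral_right) (use ij in auto)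
  also have "\<dots> n = 0" for n using ij by simp
  finally show ?thesis using that[of i ?d] ij by simp
qed

context weighted_shift
begin

text \<open>Without bad blocks from \<open>N\<close> on, the bump condition fails for every such
  block. With \<open>C\<close> the constant of that condition, this is the hypothesis of the
  dichotomy for \<open>norm (\<phi> n) powr q\<close>.\<close>

lemma bad_block_of_not_geom_decay:
  assumes p: "1 < p" and q: "1 / p + 1 / q = 1" and \<mu>: "\<mu> \<noteq> 0" and \<epsilon>: "0 < \<epsilon>"
    and nd: "\<not> geom_decay (\<lambda>n. norm (\<phi> n))" and ng: "\<not> geom_decay (\<lambda>n. 1 / norm (\<phi> n))"
  shows "\<exists>I J y. N \<le> I \<and> bad_block p \<epsilon> I J y"
proof (rule ccontr)
  assume none: "\<not> ?thesis"
  define C where "C = (2 * norm \<mu>) powr q / \<epsilon> powr (q / p)"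
  have "1 / p < 1" using p by simp
  then have "0 < 1 / q" using q by linarith
  then have q0: "0 < q" by simp
  have pos: "0 < norm (\<phi> n)" for n using \<phi>_nz[OF \<mu>] by simp
  have "geom_decay (\<lambda>n. norm (\<phi> n) powr q) \<or> geom_decay (\<lambda>n. 1 / norm (\<phi> n) powr q)"
  proof (rule geom_decay_dichotomy[where N = N and C = C])
    fix I J :: nat assume "N \<le> I" "I \<le> J"
    then show "(\<Sum>n=I..J. norm (\<phi> n) powr q) \<le> C * (norm (\<phi> I) powr q + norm (\<phi> (Suc J)) powr q)"
      using none bad_block_of_bump[OF p q \<mu> \<epsilon>, of I J] unfolding C_def by (metis not_le)
  qed (use \<phi>_nz[OF \<mu>] in simp)
  then show False
    using nd ng geom_decay_powr[OF pos q0] geom_decay_powr[of "\<lambda>n. 1 / norm (\<phi> n)", OF _ q0] pos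
    by (auto simp: powr_divide)
qed

text \<open>Gliding hump: glueing blocks with coefficients that do not tend to \<open>0\<close> gives a vector of
  \<open>\<ell>\<^sup>p\<close> outside the range of \<open>L\<close>, and splitting the blocks into infinitely many infinite classes
  makes these vectors independent modulo the range.\<close>

lemma range_L_infinite_codim:
  assumes p: "1 \<le> p" and bad: "\<And>\<epsilon> N. 0 < \<epsilon> \<Longrightarrow> \<exists>I J y. N \<le> I \<and> bad_block p \<epsilon> I J y"
    and B: "finite B" and codim: "\<And>v. v \<in> vecs (lp p) \<Longrightarrow> \<exists>x\<in>vecs (lp p). v - L x \<in> fvs.span B"
  shows False
proof -
  \<comment> \<open>Block \<open>j\<close> receives the budget \<open>(1 / 2) ^ j\<close>, so that
    all blocks together stay in l^p.\<close>
  have "\<forall>j N. \<exists>T. N \<le> fst T \<and> bad_block p ((1 / 2) ^ j) (fst T) (fst (snd T)) (snd (snd T))"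
    using bad by (metis fst_conv snd_conv zero_less_power half_gt_zero zero_less_one)
  then obtain T where T: "\<And>j N. N \<le> fst (T j N)"
      "\<And>j N. bad_block p ((1 / 2) ^ j) (fst (T j N)) (fst (snd (T j N))) (snd (snd (T j N)))"
    by metis
  define st where "st = rec_nat 0 (\<lambda>j N. Suc (fst (snd (T j N))))"
  define I where "I j = fst (T j (st j))" for j
  define J where "J j = fst (snd (T j (st j)))" for j
  define y where "y j = snd (snd (T j (st j)))" for j
  have st_Suc: "st (Suc j) = Suc (J j)" for j by (simp add: st_def J_def)
  have bb: "bad_block p ((1 / 2) ^ j) (I j) (J j) (y j)" for j unfolding I_def J_def y_def by (rule T)
  have st_I: "st j \<le> I j" for j unfolding I_def by (rule T)
  note IJ = bad_blockD(1)[OF bb] and supp = bad_blockD(2)[OF bb]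
  have st_step: "st j < st (Suc j)" for j using st_I[of j] IJ[of j] by (simp add: st_Suc)
  then have "strict_mono st" by (rule strict_monoI_Suc)
  then have mono: "st i \<le> st j" if "i \<le> j" for i j using that by (simp add: strict_mono_less_eq)
  have st_ge: "j \<le> st j" for j using \<open>strict_mono st\<close> by (rule strict_mono_imp_increasing)
  have disj: "y j n = 0" if n: "n \<in> {I k..J k}" and "j \<noteq> k" for j k n
  proof (rule supp, rule notI)
    assume j: "n \<in> {I j..J j}"
    from \<open>j \<noteq> k\<close> consider "Suc j \<le> k" | "Suc k \<le> j" by linarith
    then show False
    proof cases
      case 1 then show False using mono[OF 1] st_Suc[of j] st_I[of k] n j by simp
    next
      case 2 then show False using mono[OF 2] st_Suc[of k] st_I[of j] n j by simp
    qed
  qed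
  \<comment> \<open>The glued vector. Block \<open>j\<close> starts at or after index
    \<open>j\<close>, so the blocks beyond \<open>n\<close> vanish at \<open>n\<close> and a finite
    sum suffices.\<close>
  define V where "V c n = (\<Sum>j\<le>n. c j * y j n)" for c :: "nat \<Rightarrow> complex" and n
  have V_block: "V c n = c k * y k n" if n: "n \<in> {I k..J k}" for c k n
  proof -
    have "k \<le> n" using st_ge[of k] st_I[of k] n by simp
    then have "V c n = (\<Sum>j\<in>{k}. c j * y j n)"
      unfolding V_def using disj[OF n] by (intro sum.mono_neutral_right) auto
    then show ?thesis by simp
  qed
  have V_mem: "V c \<in> vecs (lp p)" if c: "\<And>j. norm (c j) \<le> 1" for c
  proof (rule conjunct1[OF lpI[OF p, of "2 powr (1 / p)"]])
    fix M
    have pt: "norm (V c n) powr p \<le> (\<Sum>j\<le>n. norm (y j n) powr p)" for n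
    proof (cases "\<exists>k. n \<in> {I k..J k}")
      case True
      then obtain k where k: "n \<in> {I k..J k}" ..
      have kn: "k \<le> n" using st_ge[of k] st_I[of k] k by simp
      have "norm (V c n) \<le> norm (y k n)"
        unfolding V_block[OF k] using c[of k] by (simp add: norm_mult mult_left_le_one_le)
      then have "norm (V c n) powr p \<le> norm (y k n) powr p" using p by (intro powr_mono2) auto
      also have "\<dots> \<le> (\<Sum>j\<le>n. norm (y j n) powr p)" using kn by (intro member_le_sum) auto
      finally show ?thesis .
    next
      case False
      then have "V c n = 0" unfolding V_def using supp by (intro sum.neutral) auto
      then show ?thesis by (simp add: sum_nonneg)
    qed
    have "(\<Sum>n<M. norm (V c n) powr p) \<le> (\<Sum>n<M. \<Sum>j<M. norm (y j n) powr p)"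
    proof (rule sum_mono)
      fix n assume "n \<in> {..<M}"
      then have "(\<Sum>j\<le>n. norm (y j n) powr p) \<le> (\<Sum>j<M. norm (y j n) powr p)" by (intro sum_mono2) auto
      then show "norm (V c n) powr p \<le> (\<Sum>j<M. norm (y j n) powr p)" using pt[of n] by linarith
    qed
    also have "\<dots> = (\<Sum>j<M. \<Sum>n<M. norm (y j n) powr p)" by (rule sum.swap)
    also have "\<dots> \<le> (\<Sum>j<M. (1 / 2) ^ j)" by (intro sum_mono bad_blockD(3)[OF bb])
    also have "\<dots> \<le> 2" by (simp add: sum_gp_strict)
    finally show "(\<Sum>n<M. norm (V c n) powr p) \<le> (2 powr (1 / p)) powr p" using p by (simp add: powr_powr)
  qed simp
  define m where "m = card B"
  \<comment> \<open>The blocks are split into residue classes modulo \<open>card B + 1\<close>, one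
    class more than the elements of \<open>B\<close>.\<close>
  define e where "e i j = (if j mod Suc m = i then 1 else 0 :: complex)" for i j
  have "V (e i) \<in> vecs (lp p)" for i by (rule V_mem) (simp add: e_def)
  then have "\<forall>i. \<exists>x. x \<in> vecs (lp p) \<and> V (e i) - L x \<in> fvs.span B" using codim by blast
  then obtain x where x: "\<And>i. x i \<in> vecs (lp p)" "\<And>i. V (e i) - L (x i) \<in> fvs.span B" by metis
  obtain d k where k: "k \<le> m" "d k \<noteq> 0" and d: "\<And>n. (\<Sum>i\<le>m. d i * (V (e i) - L (x i)) n) = 0"
    using span_family_dependent[OF B, of "\<lambda>i. V (e i) - L (x i)"] x(2) unfolding m_def by metis
  \<comment> \<open>By the dependence relation, \<open>L X\<close> is the corresponding combination
    of the glued vectors, hence on block \<open>j\<close> the multiple of \<open>y j\<close> by the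
    coefficient of its class.\<close>
  define X where "X n = (\<Sum>i\<le>m. d i * x i n)" for n
  have LX: "L X n = d (j mod Suc m) * y j n" if n: "n \<in> {I j..J j}" for n j
  proof -
    have "(\<Sum>i\<le>m. d i * V (e i) n) = (\<Sum>i\<le>m. d i * L (x i) n)"
      using d[of n] by (simp add: right_diff_distrib sum_subtractf)
    also have "\<dots> = L X n"
      by (simp add: L_apply X_def sum_distrib_left right_diff_distrib sum_subtractf mult.left_commute)
    finally have "L X n = (\<Sum>i\<le>m. d i * V (e i) n)" by simp
    also have "\<dots> = (\<Sum>i\<le>m. if j mod Suc m = i then d i * y j n else 0)"
      by (intro sum.cong) (simp_all add: V_block[OF n] e_def)
    also have "\<dots> = d (j mod Suc m) * y j n" using mod_less_divisor[of "Suc m" j] by (simp add: less_Suc_eq_le)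
    finally show ?thesis .
  qed
  have "x i \<longlonglongrightarrow> 0" for i
  proof -
    have "(\<lambda>n. norm (x i n) powr p) \<longlonglongrightarrow> 0" using x(1)[of i] by (intro summable_LIMSEQ_zero) (simp add: lp_def)
    then have "(\<lambda>n. (norm (x i n) powr p) powr (1 / p)) \<longlonglongrightarrow> 0 powr (1 / p)"
      by (rule tendsto_powr') (use p in auto)
    then show ?thesis using p by (simp add: powr_powr tendsto_norm_zero_iff)
  qed
  then have "(\<lambda>n. \<Sum>i\<le>m. d i * x i n) \<longlonglongrightarrow> (\<Sum>i\<le>m. d i * 0)" by (intro tendsto_intros)
  then have "X \<longlonglongrightarrow> 0" by (simp add: X_def[abs_def])
  then obtain n0 where n0: "\<And>n. n0 \<le> n \<Longrightarrow> norm (X n) < norm (d k)"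
    using LIMSEQ_D[of X 0 "norm (d k)"] k by auto
  \<comment> \<open>A block of class \<open>k\<close> so late that both its end points lie where
    \<open>X\<close> is smaller than \<open>norm (d k)\<close>.\<close>
  define j where "j = k + Suc m * n0"
  have j: "j mod Suc m = k" unfolding j_def mod_mult_self2 using k by simp
  have "n0 \<le> j" by (simp add: j_def)
  then have "n0 \<le> I j" using st_ge[of j] st_I[of j] by simp
  moreover have "norm (d k) \<le> norm (X (I j)) \<or> norm (d k) \<le> norm (X (Suc (J j)))"
    using bad_blockD(4)[OF bb[of j], of X "d k"] LX[of _ j] j by simp
  ultimately show False using n0[of "I j"] n0[of "Suc (J j)"] IJ[of j] by auto
qed

end

section \<open>Products of consecutive weights and the annulus\<close>

context weighted_shift
begin

definition P :: "nat \<Rightarrow> nat \<Rightarrow> real" where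
  "P n k = norm (\<Prod>i=1..n. \<alpha> (k + i))"

lemma P_Suc: "P (Suc n) k = P n k * norm (\<alpha> (Suc (k + n)))"
  by (simp add: P_def norm_mult)

lemma P_Suc_left: "P (Suc n) k = norm (\<alpha> (Suc k)) * P n (Suc k)"
proof (induction n)
  case (Suc n)
  show ?case unfolding P_Suc[of "Suc n" k] Suc P_Suc[of n "Suc k"] by simp
qed (simp add: P_def)

lemma P_1: "P 1 k = norm (\<alpha> (Suc k))"
  by (simp add: P_def)

lemma P_pos: "0 < P n k"
  unfolding P_def using \<alpha>_nz by simp

text \<open>The products in the annulus formula are thus the growth factors of \<open>\<phi>\<close>
  over windows, up to powers of \<open>norm \<mu>\<close>.\<close>

lemma norm_\<phi>_add:
  assumes "\<mu> \<noteq> 0"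
  shows "norm (\<phi> (k + n)) = norm (\<phi> k) * (P n k / norm \<mu> ^ n)"
proof -
  have "(\<Prod>i=1..k + n. \<alpha> i) = (\<Prod>i=1..k. \<alpha> i) * (\<Prod>i=1..n. \<alpha> (k + i))"
    by (induction n) simp_all
  then show ?thesis
    by (simp add: weight_ratio_def P_def norm_mult norm_divide norm_power power_add)
qed

end

locale bounded_weighted_shift = weighted_shift +
  fixes M :: real
  assumes \<alpha>_le: "norm (\<alpha> (Suc n)) \<le> M"
begin

lemma M_nonneg: "0 \<le> M"
  using \<alpha>_le[of 0] norm_ge_zero order_trans by blast

lemma P_le: "P n k \<le> M ^ n"
proof (induction n)
  case (Suc n)
  then show ?case using \<alpha>_le[of "k + n"] M_nonneg mult_mono[OF Suc \<alpha>_le[of "k + n"]]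
    by (simp add: P_Suc mult.commute)
qed (simp add: P_def)

lemma bdd_P: "bdd_above (P n ` A)" "bdd_below (P n ` A)"
  by - (rule bdd_aboveI2, rule P_le, rule bdd_belowI2, rule less_imp_le, rule P_pos)

lemma INF_P_le: "1 \<le> k \<Longrightarrow> (INF k\<in>{1..}. P n k) \<le> P n k"
  by (rule cINF_lower[OF bdd_P(2)]) simp

lemma P_le_SUP: "1 \<le> k \<Longrightarrow> P n k \<le> (SUP k\<in>{1..}. P n k)"
  by (rule cSUP_upper[OF _ bdd_P(1)]) simp

text \<open>A strict violation of a supremum or infimum is witnessed by one \<open>n\<close>, and
  n-th powers remove the root. The bounds \<open>M\<close> and 0 on the roots make the supremum and
  infimum genuine.\<close>

lemma not_in_annulus_iff:
  "\<not> ((SUP n\<in>{1..}. root n (INF k\<in>{1..}. P n k)) \<le> norm \<mu> \<and>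
      norm \<mu> \<le> (INF n\<in>{1..}. root n (SUP k\<in>{1..}. P n k))) \<longleftrightarrow>
   (\<exists>n\<ge>1. norm \<mu> ^ n < (INF k\<in>{1..}. P n k)) \<or> (\<exists>n\<ge>1. (SUP k\<in>{1..}. P n k) < norm \<mu> ^ n)"
proof -
  let ?i = "\<lambda>n. INF k\<in>{1..}. P n k" and ?s = "\<lambda>n. SUP k\<in>{1..}. P n k"
  have "root n (?i n) \<le> M" if "1 \<le> n" for n
  proof -
    have "root n (?i n) \<le> root n (M ^ n)" using that order_trans[OF INF_P_le P_le, of 1 n] by simp
    then show ?thesis using that M_nonneg by (simp add: real_root_power_cancel)
  qed
  then have "bdd_above ((\<lambda>n. root n (?i n)) ` {1..})" by (intro bdd_aboveI2) auto
  then have 1: "norm \<mu> < (SUP n\<in>{1..}. root n (?i n)) \<longleftrightarrow> (\<exists>n\<ge>1. norm \<mu> < root n (?i n))"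
    by (subst less_cSUP_iff) auto
  have "0 \<le> root n (?s n)" for n 
    by (rule real_root_ge_zero[OF order_trans[OF less_imp_le[OF P_pos] P_le_SUP[OF order_refl]]])
  then have "bdd_below ((\<lambda>n. root n (?s n)) ` {1..})" by (intro bdd_belowI2) auto
  then have 2: "(INF n\<in>{1..}. root n (?s n)) < norm \<mu> \<longleftrightarrow> (\<exists>n\<ge>1. root n (?s n) < norm \<mu>)"
    by (subst cINF_less_iff) auto
  have r: "norm \<mu> = root n (norm \<mu> ^ n)" if "1 \<le> n" for n using that by (simp add: real_root_power_cancel)
  have 3: "norm \<mu> < root n t \<longleftrightarrow> norm \<mu> ^ n < t" "root n t < norm \<mu> \<longleftrightarrow> t < norm \<mu> ^ n" if "1 \<le> n" for n t
    using that by (subst r[OF that], simp)+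
  show ?thesis unfolding de_Morgan_conj not_le 1 2 using 3 by blast
qed

text \<open>The witnessing \<open>n\<close> makes \<open>1 / norm (\<phi> k)\<close> or
  \<open>norm (\<phi> k)\<close> contract over all windows of length \<open>n\<close> with
  \<open>k \<ge> 1\<close>. The contraction lemma also needs a bound for single steps and disposes
  of \<open>k = 0\<close>.\<close>

lemma surj_L_outside_annulus:
  assumes p: "1 \<le> p" and y: "y \<in> vecs (lp p)"
    and out: "(\<exists>n\<ge>1. norm \<mu> ^ n < (INF k\<in>{1..}. P n k)) \<or> (\<exists>n\<ge>1. (SUP k\<in>{1..}. P n k) < norm \<mu> ^ n)"
  shows "\<exists>x\<in>vecs (lp p). L x = y"
  using out
proof
  assume "\<exists>n\<ge>1. norm \<mu> ^ n < (INF k\<in>{1..}. P n k)"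
  then obtain n where n: "1 \<le> n" and lt: "norm \<mu> ^ n < (INF k\<in>{1..}. P n k)" by auto
  define i where "i = (INF k\<in>{1..}. P n k)"
  have i: "norm \<mu> ^ n < i" "\<And>k. 1 \<le> k \<Longrightarrow> i \<le> P n k" using lt INF_P_le by (auto simp: i_def)
  have i0: "0 < i" using i(1) by (rule le_less_trans[rotated]) simp
  define B where "B = M ^ (n - 1)"
  \<comment> \<open>The other \<open>n - 1\<close> factors of a window are at most \<open>M\<close>
    each, so a lower bound for windows is one for single weights.\<close>
  have i_le: "i \<le> B * norm (\<alpha> (Suc k))" if "1 \<le> k" for k
  proof -
    obtain m where m: "n = Suc m" using n by (cases n) auto
    have "P n k = norm (\<alpha> (Suc k)) * P m (Suc k)" by (simp add: m P_Suc_left)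
    also have "\<dots> \<le> norm (\<alpha> (Suc k)) * B" using P_le[of m "Suc k"] m by (intro mult_left_mono) (auto simp: B_def)
    finally show ?thesis using i(2)[OF that] by (simp add: mult.commute)
  qed
  have B0: "0 < B"
  proof -
    have "0 < B * norm (\<alpha> (Suc 1))" using i_le[of 1] i0 by simp
    then show ?thesis using \<alpha>_nz by (simp add: zero_less_mult_iff)
  qed
  show ?thesis
  proof (cases "\<mu> = 0")
    case True
    \<comment> \<open>The infimum runs over \<open>k \<ge> 1\<close>; the weight with index 1 is the
      one it misses and enters separately.\<close>
    define \<delta> where "\<delta> = min (i / B) (norm (\<alpha> (Suc 0)))"
    have "\<delta> \<le> norm (\<alpha> (Suc k))" for k
      using i_le[of k] B0 by (cases k) (auto simp: \<delta>_def min_le_iff_disj field_simps)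
    moreover have "0 < \<delta>" using i0 B0 \<alpha>_nz by (simp add: \<delta>_def)
    ultimately show ?thesis using surj_L_0[OF p True _ _ y] by blast
  next
    case False
    have f: "0 < norm (\<phi> k)" for k using \<phi>_nz[OF False] by simp
    have m0: "0 < norm \<mu>" using False by simp
    have "geom_decay (\<lambda>k. 1 / norm (\<phi> k))"
    proof (rule geom_decay_of_contraction[of _ "norm \<mu> ^ n / i" n 1 "norm \<mu> * B / i"])
      show "0 < norm \<mu> ^ n / i" "norm \<mu> ^ n / i < 1" using m0 i0 i(1) by simp_all
    next
      fix k :: nat assume k: "1 \<le> k"
      have "norm (\<phi> (Suc k)) = norm (\<phi> k) * (norm (\<alpha> (Suc k)) / norm \<mu>)"
        using norm_\<phi>_add[OF False, of k 1] P_1[of k] by simp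
      moreover have "norm (\<phi> k) * (i / (B * norm \<mu>)) \<le> norm (\<phi> k) * (norm (\<alpha> (Suc k)) / norm \<mu>)"
        using i_le[OF k] B0 m0 by (intro mult_left_mono) (auto simp: field_simps)
      ultimately have "norm (\<phi> k) * (i / (B * norm \<mu>)) \<le> norm (\<phi> (Suc k))" by simp
      then show "1 / norm (\<phi> (Suc k)) \<le> norm \<mu> * B / i * (1 / norm (\<phi> k))"
        using f[of k] f[of "Suc k"] i0 B0 m0 by (simp add: field_simps)
      have "norm (\<phi> k) * (i / norm \<mu> ^ n) \<le> norm (\<phi> (k + n))"
        unfolding norm_\<phi>_add[OF False] using i(2)[OF k] by (intro mult_left_mono divide_right_mono) auto
      then show "1 / norm (\<phi> (k + n)) \<le> norm \<mu> ^ n / i * (1 / norm (\<phi> k))"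
        using f[of k] f[of "k + n"] i0 m0 by (simp add: field_simps)
    qed (use f n in simp_all)
    then show ?thesis by (rule surj_L_of_growth[OF p False _ y])
  qed
next
  assume "\<exists>n\<ge>1. (SUP k\<in>{1..}. P n k) < norm \<mu> ^ n"
  then obtain n where n: "1 \<le> n" and lt: "(SUP k\<in>{1..}. P n k) < norm \<mu> ^ n" by auto
  define s where "s = (SUP k\<in>{1..}. P n k)"
  have s: "s < norm \<mu> ^ n" "\<And>k. 1 \<le> k \<Longrightarrow> P n k \<le> s" using lt P_le_SUP by (auto simp: s_def)
  have s0: "0 < s" using s(2)[of 1] P_pos[of n 1] by simp
  have \<mu>: "\<mu> \<noteq> 0" using s s0 n by (cases "\<mu> = 0") (auto simp: power_0_left)
  have f: "0 < norm (\<phi> k)" for k using \<phi>_nz[OF \<mu>] by simp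
  have "geom_decay (\<lambda>k. norm (\<phi> k))"
  proof (rule geom_decay_of_contraction[of _ "s / norm \<mu> ^ n" n 1 "M / norm \<mu>"])
    show "0 < s / norm \<mu> ^ n" "s / norm \<mu> ^ n < 1" using \<mu> s s0 by (simp_all add: divide_less_eq)
  next
    fix k :: nat assume k: "1 \<le> k"
    have "norm (\<phi> (k + 1)) \<le> norm (\<phi> k) * (M / norm \<mu>)"
      unfolding norm_\<phi>_add[OF \<mu>] P_1 using \<alpha>_le[of k] by (intro mult_left_mono) (auto intro: divide_right_mono)
    then show "norm (\<phi> (Suc k)) \<le> M / norm \<mu> * norm (\<phi> k)" by (simp add: mult.commute)
    have "norm (\<phi> (k + n)) \<le> norm (\<phi> k) * (s / norm \<mu> ^ n)"
      unfolding norm_\<phi>_add[OF \<mu>] using s(2)[OF k] by (intro mult_left_mono divide_right_mono) auto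
    then show "norm (\<phi> (k + n)) \<le> s / norm \<mu> ^ n * norm (\<phi> k)" by (simp add: mult.commute)
  qed (use f n in simp_all)
  then show ?thesis by (rule surj_L_of_decay[OF p \<mu> _ y])
qed

text \<open>For \<mu> \<noteq> 0, a geometric rate would make some window factor at most 1/2, or at
  least 2, for every \<open>k\<close>, against \<open>hi\<close> or \<open>lo\<close>. For \<mu> =
  0, \<open>lo\<close> with \<open>n = 1\<close> says that the weights come arbitrarily close to
  0.\<close>

lemma bad_block_in_annulus:
  assumes p: "1 < p" and q: "1 / p + 1 / q = 1" and \<epsilon>: "0 < \<epsilon>"
    and lo: "\<And>n. 1 \<le> n \<Longrightarrow> (INF k\<in>{1..}. P n k) \<le> norm \<mu> ^ n"
    and hi: "\<And>n. 1 \<le> n \<Longrightarrow> norm \<mu> ^ n \<le> (SUP k\<in>{1..}. P n k)"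
  shows "\<exists>I J y. N \<le> I \<and> bad_block p \<epsilon> I J y"
proof (cases "\<mu> = 0")
  case True
  \<comment> \<open>Including the first weights in the minimum forces any smaller weight to lie
    beyond \<open>N\<close>.\<close>
  define \<delta> where "\<delta> = Min ((\<lambda>k. norm (\<alpha> (Suc k))) ` {..N} \<union> {\<epsilon> powr (1 / p)})"
  have "0 < \<delta>" unfolding \<delta>_def using \<alpha>_nz \<epsilon> by (subst Min_gr_iff) auto
  then obtain k where k: "P 1 k < \<delta>"
    using lo[of 1] True cINF_less_iff[OF _ bdd_P(2)[of 1 "{1..}"], of \<delta>] by fastforce
  have "\<not> k \<le> N"
  proof
    assume "k \<le> N"
    then have "\<delta> \<le> norm (\<alpha> (Suc k))" unfolding \<delta>_def by (intro Min_le) auto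
    then show False using k unfolding P_1 by simp
  qed
  moreover have "\<delta> \<le> \<epsilon> powr (1 / p)" unfolding \<delta>_def by (intro Min_le) auto
  then have "bad_block p \<epsilon> k k (\<lambda>j. if j = k then of_real (\<epsilon> powr (1 / p)) else 0)"
    using k p True \<epsilon> unfolding P_1 by (intro bad_block_0) auto
  ultimately show ?thesis using nat_le_linear by blast
next
  case False
  have f: "0 < norm (\<phi> k)" for k using \<phi>_nz[OF False] by simp
  have small: "\<exists>n\<ge>1. G * \<theta> ^ n < 1 / 2" if \<theta>: "0 < \<theta>" "\<theta> < 1" for G \<theta> :: real
  proof -
    have "(\<lambda>n. G * \<theta> ^ n) \<longlonglongrightarrow> G * 0" using \<theta> by (intro tendsto_intros LIMSEQ_power_zero) auto
    then have "eventually (\<lambda>n. G * \<theta> ^ n < 1 / 2) sequentially" by (rule order_tendstoD) simp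
    then show ?thesis using eventually_ge_at_top[of "1 :: nat"] eventually_happens'[OF sequentially_bot eventually_conj] by blast
  qed
  have "\<not> geom_decay (\<lambda>n. norm (\<phi> n))"
  proof
    assume "geom_decay (\<lambda>n. norm (\<phi> n))"
    then obtain G \<theta> where \<theta>: "0 < \<theta>" "\<theta> < 1" and le: "\<And>k i. norm (\<phi> (k + i)) \<le> G * \<theta> ^ i * norm (\<phi> k)"
      unfolding geom_decay_def by blast
    obtain n where n: "1 \<le> n" "G * \<theta> ^ n < 1 / 2" using small[OF \<theta>] by blast
    have "P n k \<le> 1 / 2 * norm \<mu> ^ n" for k
    proof -
      have "norm (\<phi> k) * (P n k / norm \<mu> ^ n) \<le> norm (\<phi> k) * (1 / 2)"
        using order_trans[OF le[of k n] mult_right_mono[OF less_imp_le[OF n(2)]]]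
        by (simp add: norm_\<phi>_add[OF False] mult.commute)
      then have "P n k / norm \<mu> ^ n \<le> 1 / 2" by (rule mult_left_le_imp_le[OF _ f])
      then show ?thesis using False by (simp add: divide_le_eq)
    qed
    then have "(SUP k\<in>{1..}. P n k) \<le> 1 / 2 * norm \<mu> ^ n" by (intro cSUP_least) auto
    moreover have "0 < norm \<mu> ^ n" using False by simp
    ultimately show False using hi[OF n(1)] by linarith
  qed
  moreover have "\<not> geom_decay (\<lambda>n. 1 / norm (\<phi> n))"
  proof
    assume "geom_decay (\<lambda>n. 1 / norm (\<phi> n))"
    then obtain G \<theta> where \<theta>: "0 < \<theta>" "\<theta> < 1"
      and le: "\<And>k i. 1 / norm (\<phi> (k + i)) \<le> G * \<theta> ^ i * (1 / norm (\<phi> k))"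
      unfolding geom_decay_def by blast
    obtain n where n: "1 \<le> n" "G * \<theta> ^ n < 1 / 2" using small[OF \<theta>] by blast
    have "2 * norm \<mu> ^ n \<le> P n k" for k
    proof -
      have "1 / norm (\<phi> (k + n)) \<le> 1 / 2 * (1 / norm (\<phi> k))"
        by (rule order_trans[OF le[of k n] mult_right_mono[OF less_imp_le[OF n(2)]]]) simp
      then have "2 * norm (\<phi> k) \<le> norm (\<phi> (k + n))" using f[of k] f[of "k + n"] by (simp add: field_simps)
      then have "norm (\<phi> k) * 2 \<le> norm (\<phi> k) * (P n k / norm \<mu> ^ n)"
        unfolding norm_\<phi>_add[OF False] by (simp only: mult.commute[of _ 2])
      then have "2 \<le> P n k / norm \<mu> ^ n" by (rule mult_left_le_imp_le[OF _ f])
      then show ?thesis using False by (simp add: le_divide_eq)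
    qed
    then have "2 * norm \<mu> ^ n \<le> (INF k\<in>{1..}. P n k)" by (intro cINF_greatest) auto
    moreover have "0 < norm \<mu> ^ n" using False by simp
    ultimately show False using lo[OF n(1)] by linarith
  qed
  ultimately show ?thesis by (rule bad_block_of_not_geom_decay[OF p q False \<epsilon>])
qed

end

section \<open>Transfer to the disc and the essential spectrum\<close>

lemma (in seq_space) bounded_op_minus_scale:
  assumes R: "bounded_op S S R"
  shows "bounded_op S S (\<lambda>x. R x - fscale \<mu> x)"
proof -
  obtain C where C: "\<And>x. x \<in> vecs S \<Longrightarrow> nrm S (R x) \<le> C * nrm S x" 
    using R unfolding bounded_op_def by blast
  have eq: "R x - fscale \<mu> x = R x + fscale (- \<mu>) x" for x by (auto simp: fscale_def)
  have "nrm S (R x + fscale (- \<mu>) x) \<le> (C + norm \<mu>) * nrm S x" if x: "x \<in> vecs S" for x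
  proof -
    have "R x \<in> vecs S" using R x by (simp add: bounded_op_def)
    then have "nrm S (R x + fscale (- \<mu>) x) \<le> nrm S (R x) + nrm S (fscale (- \<mu>) x)"
      using x by (intro triangle scale_mem)
    then show ?thesis using C[OF x] nrm_scale[OF x, of "- \<mu>"] by (simp add: distrib_right)
  qed
  then have "nrm S (R x - fscale \<mu> x) \<le> (C + norm \<mu>) * nrm S x" if "x \<in> vecs S" for x
    using that by (simp only: eq)
  moreover have "R (x + y) - fscale \<mu> (x + y) = (R x - fscale \<mu> x) + (R y - fscale \<mu> y)"
    if "x \<in> vecs S" "y \<in> vecs S" for x y
  proof -
    have "R (x + y) = R x + R y" using R that unfolding bounded_op_def by blast
    then show ?thesis by (auto simp: fscale_def algebra_simps)
  qed
  moreover have "R (fscale c x) - fscale \<mu> (fscale c x) = fscale c (R x - fscale \<mu> x)"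
    if "x \<in> vecs S" for c x
  proof -
    have "R (fscale c x) = fscale c (R x)" using R that unfolding bounded_op_def by blast
    then show ?thesis by (auto simp: fscale_def algebra_simps)
  qed
  moreover have "R x - fscale \<mu> x \<in> vecs S" if "x \<in> vecs S" for x
    using R that minus_mem scale_mem unfolding bounded_op_def by blast
  ultimately show ?thesis unfolding bounded_op_def by blast
qed

lemma (in disc_basis) fredholm_disc_shift_iff:
  assumes S: "S = lp p" and p: "1 < p" and q: "1 / p + 1 / q = 1"
    and w_nz: "\<And>n. w n \<noteq> 0"
    and bdd: "bdd_above (range (\<lambda>n. norm (w (Suc n) * (a (Suc n) / a n))))"
  shows "fredholm (disc_space S a b) (\<lambda>x. disc_shift w x - fscale \<mu> x) \<longleftrightarrow>
    \<not> ((SUP n\<in>{1..}. root n (INF k\<in>{1..}. weight_prod a w n k)) \<le> norm \<mu> \<and>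
       norm \<mu> \<le> (INF n\<in>{1..}. root n (SUP k\<in>{1..}. weight_prod a w n k)))"
proof -
  define \<alpha> where "\<alpha> n = w n * (a n / a (n - 1))" for n
  obtain M where M: "\<And>n. norm (w (Suc n) * (a (Suc n) / a n)) \<le> M" using bdd by (auto simp: bdd_above_def)
  interpret W: bounded_weighted_shift \<alpha> \<mu> M
    by unfold_locales (use M w_nz a_nz in \<open>simp_all add: \<alpha>_def\<close>)
  \<comment> \<open>The quotients of consecutive \<open>a\<close> in the weights telescope to
    \<open>a (k + n) / a k\<close>.\<close>
  have "(\<Prod>i=1..n. \<alpha> (k + i)) = (\<Prod>i=1..n. w (k + i)) * (a (k + n) / a k)" for n k
    by (induction n) (simp_all add: \<alpha>_def a_nz)
  then have P: "weight_prod a w n k = W.P n k" for n k unfolding weight_prod_def W.P_def by simp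
  have R: "bounded_op S S W.L"
    unfolding W.L_def by (intro bounded_op_minus_scale bounded_op_seq_shift[of \<alpha> M] W.\<alpha>_le)
  have T: "disc_shift w (J u) - fscale \<mu> (J u) = J (W.L u)" if u: "u \<in> vecs S" for u
  proof -
    have "seq_shift \<alpha> u \<in> vecs S" using bounded_op_seq_shift[of \<alpha>, OF W.\<alpha>_le] u by (simp add: bounded_op_def)
    then have "J (seq_shift \<alpha> u + fscale (- \<mu>) u) = J (seq_shift \<alpha> u) + fscale (- \<mu>) (J u)"
      using u J_add J_scale scale_mem by metis
    moreover have "seq_shift \<alpha> u + fscale (- \<mu>) u = W.L u" by (auto simp: W.L_def fscale_def)
    moreover have "disc_shift w (J u) = J (seq_shift \<alpha> u)" using disc_shift_J[OF u] by (simp add: \<alpha>_def[abs_def])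
    ultimately show ?thesis by (auto simp: fscale_def)
  qed
  have p1: "1 \<le> p" using p by simp
  show ?thesis
    unfolding P W.not_in_annulus_iff
  proof
    assume "fredholm (disc_space S a b) (\<lambda>x. disc_shift w x - fscale \<mu> x)"
    then obtain B where B: "finite B" "\<And>v. v \<in> vecs S \<Longrightarrow> \<exists>u\<in>vecs S. v - W.L u \<in> fvs.span B"
      using fredholm_finite_codim[OF R T] by metis
    show "(\<exists>n\<ge>1. norm \<mu> ^ n < (INF k\<in>{1..}. W.P n k)) \<or> (\<exists>n\<ge>1. (SUP k\<in>{1..}. W.P n k) < norm \<mu> ^ n)"
    proof (rule ccontr)
      assume "\<not> ?thesis"
      then have "\<And>n. 1 \<le> n \<Longrightarrow> (INF k\<in>{1..}. W.P n k) \<le> norm \<mu> ^ n"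
        "\<And>n. 1 \<le> n \<Longrightarrow> norm \<mu> ^ n \<le> (SUP k\<in>{1..}. W.P n k)" by (meson not_le)+
      from W.bad_block_in_annulus[OF p q _ this] show False
        using W.range_L_infinite_codim[OF p1 _ B(1)] B(2) unfolding S by blast
    qed
  next
    assume "(\<exists>n\<ge>1. norm \<mu> ^ n < (INF k\<in>{1..}. W.P n k)) \<or> (\<exists>n\<ge>1. (SUP k\<in>{1..}. W.P n k) < norm \<mu> ^ n)"
    then have surj: "\<exists>u\<in>vecs S. W.L u = v" if "v \<in> vecs S" for v
      using that W.surj_L_outside_annulus[OF p1] unfolding S by blast
    show "fredholm (disc_space S a b) (\<lambda>x. disc_shift w x - fscale \<mu> x)"
      by (rule fredholm_if_surj[OF R T surj]) (use W.ker_L in auto)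
  qed
qed

theorem theorem3p5:
  fixes a b w :: "nat \<Rightarrow> complex"
  assumes a_nz: "\<And>n. a n \<noteq> 0"
    and w_nz: "\<And>n. w n \<noteq> 0"
    and bdd: "bdd_above (range (\<lambda>n. norm (w (Suc n) * (a (Suc n) / a n))))"
    and limsup_lt: "limsup (\<lambda>n. ereal (norm (b n / a (Suc n)))) < 1"
    and diff_lim: "(\<lambda>n. norm (w (Suc (Suc n)) * (b (Suc n) / a (Suc n))
                             - w (Suc n) * (b n / a n))) \<longlonglongrightarrow> 0"
  shows
    "(\<forall>p q. 1 < p \<longrightarrow> 1 / p + 1 / q = 1 \<longrightarrow> dom1 q a b = ball 0 1 \<longrightarrow>
        similar_to_compact_pert (lp p) a b w) \<and>
     (dom2 a b = ball 0 1 \<longrightarrow> similar_to_compact_pert (lp 1) a b w) \<and>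
     (dom3 a b = ball 0 1 \<longrightarrow> similar_to_compact_pert c0 a b w) \<and>
     (\<forall>p q. 1 < p \<longrightarrow> 1 / p + 1 / q = 1 \<longrightarrow> dom1 q a b = ball 0 1 \<longrightarrow>
        ess_spectrum (disc_space (lp p) a b) (disc_shift w) =
          {z. (SUP n\<in>{1..}. root n (INF k\<in>{1..}. weight_prod a w n k)) \<le> norm z \<and>
              norm z \<le> (INF n\<in>{1..}. root n (SUP k\<in>{1..}. weight_prod a w n k))})"
proof -
  obtain t where t: "limsup (\<lambda>n. ereal (norm (b n / a (Suc n)))) < ereal t" "ereal t < 1"
    using ereal_dense2[OF limsup_lt] by blast
  \<comment> \<open>The maximum with 1/2 supplies the positivity of \<open>\<theta>\<close> on which
    the rescaling weights rely.\<close>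
  define \<theta> where "\<theta> = max t (1 / 2)"
  have \<theta>: "0 < \<theta>" "\<theta> < 1" using t by (auto simp: \<theta>_def)
  from Limsup_lessD[OF t(1)] obtain N where "\<And>n. N \<le> n \<Longrightarrow> ereal (norm (b n / a (Suc n))) < ereal t"
    by (auto simp: eventually_sequentially)
  then have N: "norm (b n / a (Suc n)) \<le> \<theta>" if "N \<le> n" for n
    using that by (fastforce simp: \<theta>_def)
  let ?c = "\<lambda>n. norm (a n) + norm (b n)"
  have basis: "disc_basis S a b \<theta> N"
    if "seq_space S" "\<And>r. 0 < r \<Longrightarrow> r < 1 \<Longrightarrow> bdd_above (range (\<lambda>n. ?c n * r ^ n))" for S
    using that a_nz \<theta> N by (simp add: disc_basis_def disc_basis_axioms_def)
  have bdd_of_lim: "bdd_above (range f)" if "f \<longlonglongrightarrow> 0" for f :: "nat \<Rightarrow> real"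
    using convergent_imp_Bseq[OF convergentI[OF that]] by (simp add: Bseq_eq_bounded bounded_imp_bdd_above)
  have in_dom: "of_real r \<in> ball (0::complex) 1" if "0 < r" "r < 1" for r using that by simp
  have lp: "disc_basis (lp p) a b \<theta> N"
    if p: "1 < p" and pq: "1 / p + 1 / q = 1" and dom: "dom1 q a b = ball 0 1" for p q
  proof (rule basis[OF seq_space_lp])
    fix r :: real assume r: "0 < r" "r < 1"
    have "1 / p < 1" using p by simp
    then have "0 < 1 / q" using pq by linarith
    then have q: "0 < q" by simp
    \<comment> \<open>The natural domain is evaluated at the real point \<open>r\<close> of the
      disc; terms of a convergent series tend to 0, and the root preserves this.\<close>
    have "summable (\<lambda>n. (?c n * r ^ n) powr q)" using in_dom[OF r] r unfolding dom[symmetric] by (simp add: dom1_def)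
    then have "(\<lambda>n. (?c n * r ^ n) powr q) \<longlonglongrightarrow> 0" by (rule summable_LIMSEQ_zero)
    then have "(\<lambda>n. ((?c n * r ^ n) powr q) powr (1 / q)) \<longlonglongrightarrow> 0 powr (1 / q)"
      by (rule tendsto_powr') (use q in auto)
    then have "(\<lambda>n. ?c n * r ^ n) \<longlonglongrightarrow> 0" using q r by (simp add: powr_powr)
    then show "bdd_above (range (\<lambda>n. ?c n * r ^ n))" by (rule bdd_of_lim)
  qed (use p in simp)
  have l1: "disc_basis (lp 1) a b \<theta> N" if dom: "dom2 a b = ball 0 1"
  proof (rule basis[OF seq_space_lp])
    fix r :: real assume r: "0 < r" "r < 1"
    then show "bdd_above (range (\<lambda>n. ?c n * r ^ n))"
      using in_dom[OF r] r unfolding dom[symmetric] by (simp add: dom2_def)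
  qed simp
  have c0: "disc_basis c0 a b \<theta> N" if dom: "dom3 a b = ball 0 1"
  proof (rule basis[OF seq_space_c0])
    fix r :: real assume r: "0 < r" "r < 1"
    then have "summable (\<lambda>n. ?c n * r ^ n)" using in_dom[OF r] r unfolding dom[symmetric] by (simp add: dom3_def)
    then show "bdd_above (range (\<lambda>n. ?c n * r ^ n))" by (intro bdd_of_lim summable_LIMSEQ_zero)
  qed
  show ?thesis
    using disc_basis.similar_to_compact_pert_shift[OF lp bdd] disc_basis.similar_to_compact_pert_shift[OF l1 bdd]
      disc_basis.similar_to_compact_pert_shift[OF c0 bdd]
      disc_basis.fredholm_disc_shift_iff[OF lp refl _ _ w_nz bdd]
    unfolding ess_spectrum_def by auto
qed

end
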